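(* Let $X\subset\mathbb{R}^d$ be a set of $n$ points and $k,z\in\mathbb{N}$ with $z\ge1$. Let $p=\max\left(\frac{36}{z}\log\frac{4nk^2}{z},\ \frac{36k}{z}\log(2k^3)\right)$ and let $Y$ (with weights $w$) be the output of $\textsc{SampleCoreset}(X,k,z)$. Then with constant probability, the weighted instance $(Y,k,z')$, where $z'=z$ if $p>1$ and $z'=2.5pz$ if $p\le 1$, is an $(O(1),O(1))$-coreset for the $k$-means with outliers instance $(X,k,z)$, and $|Y|=O(k\log n)$ in expectation.
   Context: Distances are Euclidean. For a (multi)set $P$ of points with positive integer weights (interpreted as multiplicities), $k$ centers $C$ and $z\ge0$, $P_z(C)$ is the multiset obtained by discarding the $z$ copies with largest $d(x,C)$, $f^P_z(C)=\sum_{x\in P_z(C)}d^2(x,C)$, and $Opt(P,k,z)=\min_C f^P_z(C)$ over sets $C$ of $k$ points of $\mathbb{R}^d$. An instance $(Y,k,z')$ is an $(\alpha,\beta)$-coreset for $(X,k,z)$ if for every set $C$ of $k$ centers and every $\kappa_1,\kappa_2>0$ with $f^Y_{\kappa_1 z'}(C)\le\kappa_2\,Opt(Y,k,z')$, we have $f^X_{\alpha\kappa_1 z}(C)\le\beta\kappa_2\,Opt(X,k,z)$. $\textsc{k-means++}(P,m)$ ($D^2$-sampling) picks $m$ points of $P$: the first uniformly at random, each subsequent one choosing $x\in P$ with probability proportional to $d^2(x,S)$ where $S$ is the set chosen so far; the output $Y=\{y_1,\dots,y_m\}$ is weighted by $w(y_i)=|Y_i|$, where $Y_1,\dots,Y_m$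 is the partition of $P$ assigning each point to its closest chosen point. Algorithm $\textsc{SampleCoreset}(X,k,z)$: if $p>1$, output $\textsc{k-means++}(X,32(k+z))$; otherwise let $S$ contain each $x\in X$ independently with probability $p$ and output $\textsc{k-means++}(S,32(k+2.5pz))$.
   Formalization: In the coreset definition the factors κ₁, κ₂ range over values ≥ 1 instead of > 0 (with arbitrarily small factors the claim fails for all constants); d, k, n ≥ 1 are assumed, and the size bound is stated for n ≥ 2. *)

theory Defs
  imports "HOL-Probability.Probability" "HOL-Probability.Product_PMF" "HOL-Library.Multiset"
begin

text \<open>
  Points of \<open>\<real>\<^sup>d\<close> are the elements of \<open>topspace (Euclidean_space d)\<close>, i.e. functions
  \<open>nat \<Rightarrow> real\<close> that vanish from index \<open>d\<close> on. The dimension is a natural number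
  and not a type, so that absolute constants can be quantified outside of it.
\<close>

type_synonym point = "nat \<Rightarrow> real"

definition edist :: "nat \<Rightarrow> point \<Rightarrow> point \<Rightarrow> real" where
  "edist d x y = L2_set (\<lambda>i. x i - y i) {..<d}"

definition dist_to :: "nat \<Rightarrow> point \<Rightarrow> point set \<Rightarrow> real" where
  "dist_to d x C = Min (edist d x ` C)"

definition centers :: "nat \<Rightarrow> nat \<Rightarrow> point set set" where
  "centers d k = {C. C \<subseteq> topspace (Euclidean_space d) \<and> finite C \<and> card C = k}"

text \<open>
  The choice only resolves ties. A real budget \<open>z\<close> allows \<open>\<lfloor>z\<rfloor>\<close> copies to be discarded
  (all of them if there are fewer).
\<close>

definition trimmed :: "nat \<Rightarrow> point multiset \<Rightarrow> real \<Rightarrow> point set \<Rightarrow> point multiset" where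
  "trimmed d P z C = (SOME Q. Q \<subseteq># P \<and> size Q = size P - nat \<lfloor>z\<rfloor> \<and>
      (\<forall>x\<in>#Q. \<forall>y\<in>#P - Q. dist_to d x C \<le> dist_to d y C))"

definition cost :: "nat \<Rightarrow> point multiset \<Rightarrow> real \<Rightarrow> point set \<Rightarrow> real" where
  "cost d P z C = (\<Sum>x\<in>#trimmed d P z C. (dist_to d x C)\<^sup>2)"

definition Opt :: "nat \<Rightarrow> point multiset \<Rightarrow> nat \<Rightarrow> real \<Rightarrow> real" where
  "Opt d P k z = (INF C\<in>centers d k. cost d P z C)"

text \<open>
  The factors \<open>\<kappa>\<^sub>1\<close>, \<open>\<kappa>\<^sub>2\<close> are bicriteria approximation factors and hence at least 1.
  If arbitrarily small factors were admitted, no absolute \<open>\<alpha>\<close>, \<open>\<beta>\<close> would do: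
  as \<open>\<kappa>\<^sub>1\<close> tends to 0, no copy of \<open>X\<close> may be discarded, although a sample misses far
  outliers of \<open>X\<close>; and if \<open>cost d Y (\<kappa>\<^sub>1 * z') C = 0\<close> (e.g. because \<open>C\<close> contains all but a
  few, light, points of \<open>Y\<close>), then letting \<open>\<kappa>\<^sub>2\<close> tend to 0 would force
  \<open>cost d X (\<alpha> * \<kappa>\<^sub>1 * z) C = 0\<close>.
\<close>

definition is_coreset ::
  "nat \<Rightarrow> nat \<Rightarrow> real \<Rightarrow> real \<Rightarrow> point multiset \<Rightarrow> real \<Rightarrow> point multiset \<Rightarrow> real \<Rightarrow> bool" where
  "is_coreset d k \<alpha> \<beta> Y z' X z \<longleftrightarrow>
     (\<forall>C\<in>centers d k. \<forall>\<kappa>\<^sub>1\<ge>1. \<forall>\<kappa>\<^sub>2\<ge>1.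
        cost d Y (\<kappa>\<^sub>1 * z') C \<le> \<kappa>\<^sub>2 * Opt d Y k z' \<longrightarrow>
        cost d X (\<alpha> * \<kappa>\<^sub>1 * z) C \<le> \<beta> * \<kappa>\<^sub>2 * Opt d X k z)"

definition weighted_mset :: "point set \<Rightarrow> (point \<Rightarrow> nat) \<Rightarrow> point multiset" where
  "weighted_mset Y w = (\<Sum>y\<in>Y. replicate_mset (w y) y)"

definition d2_next :: "nat \<Rightarrow> point set \<Rightarrow> point list \<Rightarrow> point pmf" where
  "d2_next d P ys =
     (if ys = [] then pmf_of_set P
      else embed_pmf (\<lambda>x. if x \<in> P
             then (dist_to d x (set ys))\<^sup>2 / (\<Sum>u\<in>P. (dist_to d u (set ys))\<^sup>2) else 0))"

text \<open>Sampling stops early once all of \<open>P\<close> has been chosen, as all \<open>D\<^sup>2\<close>-weights are then 0.\<close>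

primrec d2_sample :: "nat \<Rightarrow> point set \<Rightarrow> nat \<Rightarrow> point list pmf" where
  "d2_sample d P 0 = return_pmf []"
| "d2_sample d P (Suc m) =
     bind_pmf (d2_sample d P m)
       (\<lambda>ys. if P \<subseteq> set ys then return_pmf ys
             else map_pmf (\<lambda>y. ys @ [y]) (d2_next d P ys))"

text \<open>
  A rule \<open>\<tau>\<close> for choosing, for each point \<open>x\<close>, a closest point \<open>\<tau> ys x\<close> among the
  chosen points \<open>ys\<close>; it fixes how ties are broken in the partition.
\<close>

definition closest_rule :: "nat \<Rightarrow> (point list \<Rightarrow> point \<Rightarrow> point) \<Rightarrow> bool" where
  "closest_rule d \<tau> \<longleftrightarrow>
     (\<forall>ys x. ys \<noteq> [] \<and> set ys \<subseteq> topspace (Euclidean_space d) \<and> x \<in> topspace (Euclidean_space d) \<longrightarrow>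
        \<tau> ys x \<in> set ys \<and> edist d x (\<tau> ys x) = dist_to d x (set ys))"

definition kmeanspp ::
  "nat \<Rightarrow> (point list \<Rightarrow> point \<Rightarrow> point) \<Rightarrow> point set \<Rightarrow> nat \<Rightarrow> (point set \<times> (point \<Rightarrow> nat)) pmf" where
  "kmeanspp d \<tau> P m =
     map_pmf (\<lambda>ys. (set ys, \<lambda>y. card {x \<in> P. \<tau> ys x = y})) (d2_sample d P m)"

definition sample_prob :: "nat \<Rightarrow> nat \<Rightarrow> nat \<Rightarrow> real" where
  "sample_prob n k z =
     max (36 / real z * ln (4 * real n * (real k)\<^sup>2 / real z))
         (36 * real k / real z * ln (2 * real k ^ 3))"

definition subsample :: "point set \<Rightarrow> real \<Rightarrow> point set pmf" where
  "subsample X p = map_pmf (\<lambda>b. {x \<in> X. b x}) (Pi_pmf X False (\<lambda>_. bernoulli_pmf p))"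

definition sample_coreset ::
  "nat \<Rightarrow> (point list \<Rightarrow> point \<Rightarrow> point) \<Rightarrow> point set \<Rightarrow> nat \<Rightarrow> nat \<Rightarrow> (point set \<times> (point \<Rightarrow> nat)) pmf" where
  "sample_coreset d \<tau> X k z =
     (let p = sample_prob (card X) k z in
      if p > 1 then kmeanspp d \<tau> X (32 * (k + z))
      else bind_pmf (subsample X p)
             (\<lambda>S. kmeanspp d \<tau> S (nat \<lceil>32 * (real k + 2.5 * p * real z)\<rceil>)))"

end

theory Submission
  imports Defs
begin

text \<open>
  Write \<open>Opt\<close> for the optimum with \<open>k\<close> centres and \<open>z\<close> outliers. Giving every outlier its own centre
  shows that \<open>k + z\<close> centres suffice for cost \<open>O(Opt)\<close> without outliers. As long as the cost of
  the chosen points exceeds a large multiple of this, a \<open>D\<^sup>2\<close>-sample makes a further reference cluster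
  cheap with probability at least \<open>1/16\<close>; hence \<open>32 (k + z)\<close> samples bring the cost down to
  \<open>O(Opt)\<close> with constant probability. Moving every point to its closest chosen point then changes
  all costs by \<open>O(Opt)\<close> only, up to constant factors.

  For the preliminary uniform sample, fix one near-optimal solution. With constant probability
  its outliers and its cost are represented at most proportionally (Markov), and each of its
  clusters with at least \<open>z / k\<close> points is represented at least proportionally (an exponential moment
  bound). These finitely many events suffice for all centre sets simultaneously: the smaller clusters,
  and those of which the given centres discard half of the sample, contain \<open>O(z)\<close> points and may be
  discarded, while each point of another cluster is served via the average undiscarded sample point of
  its cluster.
\<close>

section \<open>Squared distances and trimmed costs\<close>

text \<open>Squared distances spare the square roots: the triangle inequality survives up to a
  factor 2, which is enough for constant-factor bounds.\<close>

definition sqd :: "nat \<Rightarrow> point \<Rightarrow> point \<Rightarrow> real" where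
  "sqd d x y = (edist d x y)\<^sup>2"

definition dsq :: "nat \<Rightarrow> point \<Rightarrow> point set \<Rightarrow> real" where
  "dsq d x C = (dist_to d x C)\<^sup>2"

lemma sqd_eq_sum: "sqd d x y = (\<Sum>i<d. (x i - y i)\<^sup>2)"
  by (simp add: sqd_def edist_def L2_set_def sum_nonneg)

lemma edist_nonneg: "0 \<le> edist d x y"
  by (simp add: edist_def L2_set_nonneg)

lemma sqd_nonneg [simp]: "0 \<le> sqd d x y"
  by (simp add: sqd_def)

lemma dsq_nonneg [simp]: "0 \<le> dsq d x C"
  by (simp add: dsq_def)

lemma sqd_self [simp]: "sqd d x x = 0"
  by (simp add: sqd_eq_sum)

lemma sqd_commute: "sqd d x y = sqd d y x"
  by (simp add: sqd_eq_sum power2_commute)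

text \<open>Coordinatewise, (a + b)^2 <= 2 a^2 + 2 b^2, the difference of the two sides being (a -
  b)^2.\<close>

lemma sqd_triangle: "sqd d x z \<le> 2 * sqd d x y + 2 * sqd d y z"
proof -
  have "(x i - z i)\<^sup>2 \<le> 2 * (x i - y i)\<^sup>2 + 2 * (y i - z i)\<^sup>2" for i
  proof -
    have "0 \<le> ((x i - y i) - (y i - z i))\<^sup>2"
      by simp
    then show ?thesis
      by (simp add: power2_eq_square algebra_simps)
  qed
  then show ?thesis
    unfolding sqd_eq_sum sum_distrib_left sum.distrib[symmetric] by (intro sum_mono)
qed

lemma sqd_eq_0_iff:
  assumes "x \<in> topspace (Euclidean_space d)" "y \<in> topspace (Euclidean_space d)"
  shows "sqd d x y = 0 \<longleftrightarrow> x = y"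
proof
  assume "sqd d x y = 0"
  then have *: "x i = y i" if "i < d" for i
    using that by (simp add: sqd_eq_sum sum_nonneg_eq_0_iff)
  show "x = y"
  proof
    fix i show "x i = y i"
      using assms * by (cases "i < d") (auto simp: topspace_Euclidean_space)
  qed
qed simp

lemma dsq_attained:
  assumes "finite C" "C \<noteq> {}"
  obtains c where "c \<in> C" "dsq d x C = sqd d x c"
proof -
  have "Min (edist d x ` C) \<in> edist d x ` C"
    using assms by simp
  then obtain c where "c \<in> C" "Min (edist d x ` C) = edist d x c"
    by auto
  then show ?thesis
    by (intro that) (simp_all add: dsq_def sqd_def dist_to_def)
qed

lemma dsq_le_sqd:
  assumes "finite C" "c \<in> C"
  shows "dsq d x C \<le> sqd d x c"
proof -
  have "Min (edist d x ` C) \<in> edist d x ` C"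
    using assms by (intro Min_in) auto
  then have "0 \<le> dist_to d x C"
    by (auto simp: dist_to_def edist_nonneg)
  moreover have "dist_to d x C \<le> edist d x c"
    unfolding dist_to_def using assms by simp
  ultimately show ?thesis
    unfolding dsq_def sqd_def by (rule power_mono[rotated])
qed

lemma dsq_antimono:
  assumes "finite C" "B \<subseteq> C" "B \<noteq> {}"
  shows "dsq d x C \<le> dsq d x B"
proof -
  obtain b where "b \<in> B" "dsq d x B = sqd d x b"
    using dsq_attained[of B] assms finite_subset by metis
  then show ?thesis
    using dsq_le_sqd[of C b d x] assms by auto
qed

text \<open>The centre closest to \<open>y\<close> is also available to \<open>x\<close>.\<close>

lemma dsq_triangle:
  assumes "finite C" "C \<noteq> {}"
  shows "dsq d x C \<le> 2 * sqd d x y + 2 * dsq d y C"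
proof -
  obtain c where c: "c \<in> C" "dsq d y C = sqd d y c"
    using dsq_attained assms by metis
  have "dsq d x C \<le> sqd d x c"
    using assms c by (simp add: dsq_le_sqd)
  also have "\<dots> \<le> 2 * sqd d x y + 2 * sqd d y c"
    by (rule sqd_triangle)
  finally show ?thesis
    using c by simp
qed

lemma dsq_eq_0: "\<lbrakk>finite C; x \<in> C\<rbrakk> \<Longrightarrow> dsq d x C = 0"
  using dsq_le_sqd[of C x d x] by (simp add: order_antisym)

lemma dsq_pos:
  assumes "finite C" "C \<noteq> {}" "C \<subseteq> topspace (Euclidean_space d)"
    and "x \<in> topspace (Euclidean_space d)" "x \<notin> C"
  shows "0 < dsq d x C"
proof -
  obtain c where c: "c \<in> C" "dsq d x C = sqd d x c"
    using dsq_attained assms by metis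
  then have "sqd d x c \<noteq> 0"
    using sqd_eq_0_iff[of x d c] assms by auto
  then show ?thesis
    using c sqd_nonneg[of d x c] by linarith
qed

section \<open>Trimmed multisets and their costs\<close>

lemma exists_smallest_submset:
  fixes f :: "'a \<Rightarrow> real"
  assumes "n \<le> size P"
  shows "\<exists>Q. Q \<subseteq># P \<and> size Q = n \<and> (\<forall>x\<in>#Q. \<forall>y\<in>#P - Q. f x \<le> f y)"
  using assms
proof (induction n)
  case 0
  show ?case by (intro exI[of _ "{#}"]) auto
next
  case (Suc n)
  then obtain Q where Q: "Q \<subseteq># P" "size Q = n" "\<forall>x\<in>#Q. \<forall>y\<in>#P - Q. f x \<le> f y"
    by auto
  have "size (P - Q) > 0"
    using Suc.prems Q by (simp add: size_Diff_submset)
  then have "set_mset (P - Q) \<noteq> {}"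
    by fastforce
  then obtain y where y: "y \<in># P - Q" "\<forall>u\<in>#P - Q. f y \<le> f u"
    using arg_min_if_finite[of "set_mset (P - Q)" f] by (meson finite_set_mset linorder_not_less)
  have "add_mset y Q \<subseteq># P"
    using Q(1) y(1) by (metis add_mset_add_single mset_subset_eq_single subset_mset.add_left_mono
        subset_mset.add_diff_inverse)
  moreover have "u \<in># P - Q" if "u \<in># P - add_mset y Q" for u
    using that by (metis add_mset_add_single diff_diff_add_mset in_diffD)
  ultimately show ?case
    using Q y by (intro exI[of _ "add_mset y Q"]) auto
qed

text \<open>Taking a smallest remaining element again and again yields a witness, so the choice in
  \<open>trimmed\<close> meets its specification.\<close>

lemma trimmed_props:
  shows trimmed_subset: "trimmed d P z C \<subseteq># P"
    and size_trimmed: "size (trimmed d P z C) = size P - nat \<lfloor>z\<rfloor>"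
    and trimmed_le: "\<lbrakk>x \<in># trimmed d P z C; y \<in># P - trimmed d P z C\<rbrakk> \<Longrightarrow> dist_to d x C \<le> dist_to d y C"
proof -
  have "\<exists>Q. Q \<subseteq># P \<and> size Q = size P - nat \<lfloor>z\<rfloor> \<and>
      (\<forall>x\<in>#Q. \<forall>y\<in>#P - Q. dist_to d x C \<le> dist_to d y C)"
    by (rule exists_smallest_submset) simp
  from someI_ex[OF this] show "trimmed d P z C \<subseteq># P"
    "size (trimmed d P z C) = size P - nat \<lfloor>z\<rfloor>"
    "\<lbrakk>x \<in># trimmed d P z C; y \<in># P - trimmed d P z C\<rbrakk> \<Longrightarrow> dist_to d x C \<le> dist_to d y C"
    unfolding trimmed_def by blast+
qed

lemma sum_mset_real_nonneg:
  fixes f :: "'a \<Rightarrow> real"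
  shows "(\<And>x. 0 \<le> f x) \<Longrightarrow> 0 \<le> (\<Sum>x\<in>#A. f x)"
  by (induction A) auto

lemma cost_nonneg [simp]: "0 \<le> cost d P z C"
  by (simp add: cost_def sum_mset_real_nonneg)

lemma cost_eq: "cost d P z C = (\<Sum>x\<in>#trimmed d P z C. dsq d x C)"
  by (simp add: cost_def dsq_def)

text \<open>Together with \<open>cost_le\<close>, this characterises \<open>cost\<close> as the
  least sum over submultisets that omit at most \<open>z\<close> copies, so \<open>trimmed\<close>
  rarely has to be unfolded.\<close>

lemma cost_attained:
  assumes "0 \<le> z"
  obtains Q where "Q \<subseteq># P" "real (size (P - Q)) \<le> z" "cost d P z C = (\<Sum>x\<in>#Q. dsq d x C)"
proof -
  have "real (size (P - trimmed d P z C)) \<le> real (nat \<lfloor>z\<rfloor>)"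
    by (simp add: size_Diff_submset trimmed_subset size_trimmed)
  also have "\<dots> \<le> z"
    using assms by linarith
  finally show ?thesis
    using that[OF trimmed_subset] cost_eq by blast
qed

lemma sum_mset_le_size:
  fixes f :: "'a \<Rightarrow> real"
  shows "(\<And>x. x \<in># A \<Longrightarrow> f x \<le> M) \<Longrightarrow> (\<Sum>x\<in>#A. f x) \<le> real (size A) * M"
  by (induction A) (auto simp: algebra_simps intro: add_mono)

lemma size_le_sum_mset:
  fixes f :: "'a \<Rightarrow> real"
  shows "(\<And>x. x \<in># A \<Longrightarrow> M \<le> f x) \<Longrightarrow> real (size A) * M \<le> (\<Sum>x\<in>#A. f x)"
  by (induction A) (auto simp: algebra_simps intro: add_mono)

text \<open>An exchange argument: once the common part of \<open>T\<close> and \<open>Q\<close> is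
  cancelled, \<open>T - Q\<close> has no more elements than \<open>Q - T\<close>, and each of them
  is at most as far from \<open>C\<close> as any element of \<open>Q - T\<close>, which was trimmed
  away.\<close>

lemma cost_le:
  assumes "finite C" "C \<noteq> {}" "Q \<subseteq># P" "real (size (P - Q)) \<le> z"
  shows "cost d P z C \<le> (\<Sum>x\<in>#Q. dsq d x C)"
proof -
  define T where "T = trimmed d P z C"
  have T: "T \<subseteq># P" "size T = size P - nat \<lfloor>z\<rfloor>"
    by (simp_all add: T_def trimmed_subset size_trimmed)
  have dist_nonneg: "0 \<le> dist_to d x C" for x
  proof -
    have "Min (edist d x ` C) \<in> edist d x ` C"
      using assms by (intro Min_in) auto
    then show ?thesis
      by (auto simp: dist_to_def edist_nonneg)
  qed
  have le: "dsq d x C \<le> dsq d y C" if "x \<in># T" "y \<in># P - T" for x y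
    using trimmed_le[of x d P z C y] that dist_nonneg unfolding T_def dsq_def
    by (intro power_mono) auto
  have "size (P - Q) \<le> nat \<lfloor>z\<rfloor>"
    using assms(4) by linarith
  then have "size T \<le> size Q"
    using T(2) assms(3) by (simp add: size_Diff_submset)
  moreover have dT: "T = (T \<inter># Q) + (T - Q)"
    by (metis diff_intersect_left_idem inter_mset_def subset_mset.add_diff_inverse subset_mset.inf_le1)
  moreover have dQ: "Q = (T \<inter># Q) + (Q - T)"
    by (metis diff_intersect_left_idem inter_mset_def subset_mset.add_diff_inverse subset_mset.inf_le1
        subset_mset.inf_commute)
  ultimately have sz: "size (T - Q) \<le> size (Q - T)"
    by (metis add_le_cancel_left size_union)
  have "(\<Sum>x\<in>#T - Q. dsq d x C) \<le> (\<Sum>x\<in>#Q - T. dsq d x C)"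
  proof (cases "T - Q = {#}")
    case True
    then show ?thesis by (simp add: sum_mset_real_nonneg)
  next
    case False
    \<comment> \<open>\<open>M\<close> separates the values on the two differences; the empty case
      is split off because \<open>Max\<close> needs an element.\<close>
    define M where "M = Max ((\<lambda>x. dsq d x C) ` set_mset (T - Q))"
    have "M \<in> (\<lambda>x. dsq d x C) ` set_mset (T - Q)"
      unfolding M_def using False by (intro Max_in) auto
    then obtain x where x: "x \<in># T - Q" "M = dsq d x C"
      by auto
    have "(\<Sum>x\<in>#T - Q. dsq d x C) \<le> real (size (T - Q)) * M"
      by (rule sum_mset_le_size) (auto simp: M_def)
    also have "\<dots> \<le> real (size (Q - T)) * M"
      using sz x by (intro mult_right_mono) auto
    also have "\<dots> \<le> (\<Sum>x\<in>#Q - T. dsq d x C)"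
    proof (rule size_le_sum_mset)
      fix y assume "y \<in># Q - T"
      then have "y \<in># P - T"
        using assms(3) by (auto simp: in_diff_count dest: mset_subset_eq_count[of Q P y])
      then show "M \<le> dsq d y C"
        using le x by (metis in_diffD)
    qed
    finally show ?thesis .
  qed
  then have "(\<Sum>x\<in>#T. dsq d x C) \<le> (\<Sum>x\<in>#Q. dsq d x C)"
    by (subst dT, subst dQ) simp
  then show ?thesis
    by (simp add: cost_eq T_def)
qed

text \<open>Instances without multiplicities can thus be handled with subsets and
  cardinalities.\<close>

lemma subset_mset_mset_set:
  assumes "finite X" "Q \<subseteq># mset_set X"
  shows "Q = mset_set (set_mset Q)" "set_mset Q \<subseteq> X"
proof -
  show "set_mset Q \<subseteq> X"
    using assms by (metis set_mset_mono finite_set_mset_mset_set)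
  show "Q = mset_set (set_mset Q)"
  proof (rule multiset_eqI)
    fix x
    have "count Q x \<le> count (mset_set X) x"
      using assms(2) by (simp add: subseteq_mset_def)
    then have "count Q x \<le> 1"
      by (simp add: count_mset_set' split: if_splits)
    then have "count Q x = (if x \<in># Q then 1 else 0)"
      by (metis le_antisym less_one not_in_iff not_le)
    then show "count Q x = count (mset_set (set_mset Q)) x"
      by (simp add: count_mset_set')
  qed
qed

lemma cost_set_attained:
  assumes "finite X" "0 \<le> z"
  obtains Q where "Q \<subseteq> X" "real (card (X - Q)) \<le> z" "cost d (mset_set X) z C = (\<Sum>x\<in>Q. dsq d x C)"
proof -
  obtain Q where Q: "Q \<subseteq># mset_set X" "real (size (mset_set X - Q)) \<le> z"
    "cost d (mset_set X) z C = (\<Sum>x\<in>#Q. dsq d x C)"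
    using cost_attained assms by metis
  define R where "R = set_mset Q"
  have R: "Q = mset_set R" "R \<subseteq> X"
    using subset_mset_mset_set[OF assms(1) Q(1)] by (auto simp: R_def)
  show ?thesis
  proof (rule that)
    show "real (card (X - R)) \<le> z"
      using Q(2) R assms(1) by (simp flip: mset_set_Diff)
    show "cost d (mset_set X) z C = (\<Sum>x\<in>R. dsq d x C)"
      using Q(3) R by (simp add: sum_unfold_sum_mset)
  qed (fact R)
qed

lemma cost_set_le:
  assumes "finite C" "C \<noteq> {}" "finite X" "Q \<subseteq> X" "real (card (X - Q)) \<le> z"
  shows "cost d (mset_set X) z C \<le> (\<Sum>x\<in>Q. dsq d x C)"
proof -
  have "cost d (mset_set X) z C \<le> (\<Sum>x\<in>#mset_set Q. dsq d x C)"
    using assms by (intro cost_le) (auto simp: subset_imp_msubset_mset_set simp flip: mset_set_Diff)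
  then show ?thesis
    by (simp add: sum_unfold_sum_mset)
qed

section \<open>Centre sets and the optimum\<close>

lemma centersD:
  assumes "C \<in> centers d k" "1 \<le> k"
  shows "finite C" "C \<noteq> {}"
  using assms by (auto simp: centers_def)

lemma infinite_Euclidean_space:
  assumes "1 \<le> d"
  shows "infinite (topspace (Euclidean_space d))"
proof
  assume "finite (topspace (Euclidean_space d))"
  moreover have "range (\<lambda>t i. if i = 0 then t else 0 :: real) \<subseteq> topspace (Euclidean_space d)"
    using assms by (auto simp: topspace_Euclidean_space)
  ultimately have "finite (range (\<lambda>t i. if i = (0::nat) then t else 0 :: real))"
    by (rule finite_subset[rotated])
  moreover have "inj (\<lambda>t i. if i = (0::nat) then t else 0 :: real)"
    by (rule injI) (metis (mono_tags))
  ultimately have "finite (UNIV :: real set)"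
    by (rule finite_imageD)
  then show False
    using infinite_UNIV_char_0 by blast
qed

text \<open>\<open>centers\<close> demands exactly \<open>k\<close> points, so smaller sets are
  padded; \<open>1 \<le> d\<close> supplies infinitely many points for this.\<close>

lemma centers_superset:
  assumes "1 \<le> d" "finite Q" "Q \<subseteq> topspace (Euclidean_space d)" "card Q \<le> k"
  obtains C where "C \<in> centers d k" "Q \<subseteq> C"
proof -
  have "infinite (topspace (Euclidean_space d) - Q)"
    using infinite_Euclidean_space assms by simp
  then obtain B where B: "B \<subseteq> topspace (Euclidean_space d) - Q" "finite B" "card B = k - card Q"
    using infinite_arbitrarily_large by metis
  have "card (Q \<union> B) = k"
    using B assms by (subst card_Un_disjoint) auto
  then show ?thesis
    using that[of "Q \<union> B"] B assms by (auto simp: centers_def)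
qed

lemma Opt_le: "C \<in> centers d k \<Longrightarrow> Opt d P k z \<le> cost d P z C"
  unfolding Opt_def by (rule cINF_lower) (auto intro!: bdd_belowI2[where m = 0])

text \<open>Centre sets must exist here, as the infimum of an empty set of reals is
  unspecified.\<close>

lemma Opt_nonneg:
  assumes "1 \<le> d"
  shows "0 \<le> Opt d P k z"
proof -
  obtain C where "C \<in> centers d k"
    using centers_superset[of d "{}" k] assms by auto
  then show ?thesis
    unfolding Opt_def by (intro cINF_greatest) auto
qed

text \<open>Compactness is avoided by a separation argument: at cost below
  \<open>\<delta> / 4\<close>, two kept points sharing a centre would be at squared distance below
  \<open>\<delta>\<close>. So at most \<open>k\<close> points are kept, and they can serve as
  centres themselves.\<close>

lemma Opt_eq_0_attained:
  assumes "1 \<le> d" "1 \<le> k" "finite X" "X \<subseteq> topspace (Euclidean_space d)" "0 \<le> z"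
    and "Opt d (mset_set X) k z = 0"
  obtains C where "C \<in> centers d k" "cost d (mset_set X) z C = 0"
proof -
  define \<Delta> where "\<Delta> = (\<lambda>(x, y). sqd d x y) ` (X \<times> X - Id)"
  \<comment> \<open>The 1 keeps the minimum defined when \<open>X\<close> has fewer than two
    points.\<close>
  define \<delta> where "\<delta> = Min (insert 1 \<Delta>)"
  have "finite \<Delta>"
    unfolding \<Delta>_def using assms(3) by (intro finite_imageI finite_Diff finite_cartesian_product)
  moreover have "0 < r" if r: "r \<in> \<Delta>" for r
  proof -
    obtain x y where "x \<in> X" "y \<in> X" "x \<noteq> y" "r = sqd d x y"
      using r by (auto simp: \<Delta>_def)
    then show ?thesis
      using sqd_eq_0_iff[of x d y] assms(4) sqd_nonneg[of d x y] by (auto simp: subset_iff less_le)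
  qed
  ultimately have \<delta>: "0 < \<delta>" "\<And>r. r \<in> \<Delta> \<Longrightarrow> \<delta> \<le> r"
    by (auto simp: \<delta>_def)
  have "\<exists>C\<in>centers d k. cost d (mset_set X) z C < \<delta> / 4"
  proof -
    have "centers d k \<noteq> {}"
      using centers_superset[of d "{}" k] assms by auto
    then have "Inf (cost d (mset_set X) z ` centers d k) < \<delta> / 4"
      using assms \<delta> by (simp add: Opt_def)
    then show ?thesis
      using \<open>centers d k \<noteq> {}\<close> by (subst (asm) cInf_less_iff) (auto intro!: bdd_belowI2[where m = 0])
  qed
  then obtain C where C: "C \<in> centers d k" "cost d (mset_set X) z C < \<delta> / 4"
    by blast
  note Cf = centersD[OF C(1) assms(2)]
  obtain Q where Q: "Q \<subseteq> X" "real (card (X - Q)) \<le> z" "cost d (mset_set X) z C = (\<Sum>x\<in>Q. dsq d x C)"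
    using cost_set_attained assms by metis
  have "finite Q"
    using Q assms finite_subset by auto
  define h where "h x = (SOME c. c \<in> C \<and> dsq d x C = sqd d x c)" for x
  have h: "h x \<in> C" "dsq d x C = sqd d x (h x)" for x
    using someI_ex[of "\<lambda>c. c \<in> C \<and> dsq d x C = sqd d x c"] dsq_attained[OF Cf, of d x]
    unfolding h_def by blast+
  have "inj_on h Q"
  proof (rule inj_onI, rule ccontr)
    fix x y assume xy: "x \<in> Q" "y \<in> Q" "h x = h y" "x \<noteq> y"
    have small: "sqd d u (h u) < \<delta> / 4" if "u \<in> Q" for u
      using member_le_sum[of u Q "\<lambda>x. dsq d x C"] \<open>finite Q\<close> that Q C h(2) by simp
    have "sqd d x y \<le> 2 * sqd d x (h x) + 2 * sqd d y (h y)"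
      using sqd_triangle[of d x y "h x"] xy(3) by (simp add: sqd_commute)
    then have "sqd d x y < \<delta>"
      using small[of x] small[of y] xy by linarith
    moreover have "sqd d x y \<in> \<Delta>"
      using xy Q by (force simp: \<Delta>_def)
    ultimately show False
      using \<delta>(2) by force
  qed
  then have "card Q \<le> card C"
    using h Cf by (intro card_inj_on_le) auto
  then obtain C' where C': "C' \<in> centers d k" "Q \<subseteq> C'"
    using centers_superset[of d Q k] assms \<open>finite Q\<close> Q C by (auto simp: centers_def)
  note C'f = centersD[OF C'(1) assms(2)]
  have "cost d (mset_set X) z C' \<le> (\<Sum>x\<in>Q. dsq d x C')"
    using C'f assms Q by (intro cost_set_le) auto
  also have "\<dots> = 0"
    using C'(2) C'f by (intro sum.neutral) (auto intro!: dsq_eq_0)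
  finally show ?thesis
    using that C' by (simp add: order_antisym)
qed

text \<open>A positive infimum leaves room below its double; for infimum 0 the previous lemma
  supplies exact centres.\<close>

lemma near_optimal_centers:
  assumes "1 \<le> d" "1 \<le> k" "finite X" "X \<subseteq> topspace (Euclidean_space d)" "0 \<le> z"
  obtains C where "C \<in> centers d k" "cost d (mset_set X) z C \<le> 2 * Opt d (mset_set X) k z"
proof (cases "Opt d (mset_set X) k z = 0")
  case True
  then show ?thesis
    using Opt_eq_0_attained[OF assms] that by (metis mult_zero_right order_refl)
next
  case False
  have ne: "centers d k \<noteq> {}"
    using centers_superset[of d "{}" k] assms by auto
  have "Inf (cost d (mset_set X) z ` centers d k) < 2 * Opt d (mset_set X) k z"
    using False Opt_nonneg[of d "mset_set X" k z] assms unfolding Opt_def[symmetric] by simp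
  then show ?thesis
    using ne that by (subst (asm) cInf_less_iff) (force intro!: bdd_belowI2[where m = 0])+
qed

section \<open>\<open>D\<^sup>2\<close>-sampling\<close>

text \<open>A point not yet chosen has positive weight, so the normalising sum is positive and
  \<open>embed_pmf\<close> receives a genuine probability function.\<close>

lemma pmf_d2_next:
  assumes "finite P" "P \<subseteq> topspace (Euclidean_space d)" "ys \<noteq> []" "set ys \<subseteq> P" "\<not> P \<subseteq> set ys"
  shows "0 < (\<Sum>u\<in>P. dsq d u (set ys))"
    and "pmf (d2_next d P ys) x = (if x \<in> P then dsq d x (set ys) / (\<Sum>u\<in>P. dsq d u (set ys)) else 0)"
proof -
  obtain u where u: "u \<in> P" "u \<notin> set ys"
    using assms(5) by blast
  have "0 < dsq d u (set ys)"
    using u assms by (intro dsq_pos) auto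
  then show pos: "0 < (\<Sum>u\<in>P. dsq d u (set ys))"
    using u assms(1) by (intro sum_pos2[of P u]) auto
  let ?f = "\<lambda>x. if x \<in> P then dsq d x (set ys) / (\<Sum>u\<in>P. dsq d u (set ys)) else 0"
  have "(\<integral>\<^sup>+x. ennreal (?f x) \<partial>count_space UNIV) = (\<Sum>x\<in>P. ennreal (?f x))"
    using assms(1) by (intro nn_integral_count_space'[THEN trans]) (auto split: if_splits)
  also have "\<dots> = ennreal (\<Sum>x\<in>P. ?f x)"
    using pos by (intro sum_ennreal) (auto intro!: divide_nonneg_pos)
  also have "(\<Sum>x\<in>P. ?f x) = 1"
    using pos by (simp flip: sum_divide_distrib)
  finally have "pmf (embed_pmf ?f) x = ?f x"
    using pos by (intro pmf_embed_pmf) (auto intro!: divide_nonneg_pos)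
  then show "pmf (d2_next d P ys) x = ?f x"
    using assms(3) unfolding d2_next_def dsq_def by simp
qed

lemma set_pmf_d2_next:
  assumes "finite P" "P \<subseteq> topspace (Euclidean_space d)" "set ys \<subseteq> P" "\<not> P \<subseteq> set ys"
  shows "set_pmf (d2_next d P ys) \<subseteq> P"
proof (cases "ys = []")
  case True
  then show ?thesis
    using assms by (auto simp: d2_next_def set_pmf_of_set)
next
  case False
  then show ?thesis
    using pmf_d2_next(2)[OF assms(1,2) False assms(3,4)] by (auto simp: set_pmf_eq)
qed

lemma set_pmf_d2_sample:
  assumes "finite P" "P \<subseteq> topspace (Euclidean_space d)"
  shows "ys \<in> set_pmf (d2_sample d P m) \<Longrightarrow>
    set ys \<subseteq> P \<and> length ys \<le> m \<and> (P \<noteq> {} \<and> 1 \<le> m \<longrightarrow> ys \<noteq> [])"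
proof (induction m arbitrary: ys)
  case 0
  then show ?case by simp
next
  case (Suc m)
  then obtain xs where xs: "xs \<in> set_pmf (d2_sample d P m)"
    "ys \<in> set_pmf (if P \<subseteq> set xs then return_pmf xs else map_pmf (\<lambda>y. xs @ [y]) (d2_next d P xs))"
    by auto
  note IH = Suc.IH[OF xs(1)]
  show ?case
  proof (cases "P \<subseteq> set xs")
    case True
    then show ?thesis
      using xs IH by auto
  next
    case False
    then show ?thesis
      using xs IH set_pmf_d2_next[OF assms, of xs] by auto
  qed
qed

text \<open>Finite support makes every real function integrable and turns expectations into finite
  sums.\<close>

lemma finite_set_pmf_d2_sample:
  assumes "finite P" "P \<subseteq> topspace (Euclidean_space d)"
  shows "finite (set_pmf (d2_sample d P m))"
  by (rule finite_subset[OF _ finite_lists_length_le[OF assms(1), of m]])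
    (use set_pmf_d2_sample[OF assms] in blast)

text \<open>A \<open>D\<^sup>2\<close>-sample from a cluster that is still expensive is likely to be close to its centre: by
  Markov's inequality at least \<open>3/4\<close> of the points are within twice the root mean square radius of
  the centre, and since the chosen points are far away, these points carry a constant fraction of
  the weight.\<close>

lemma expensive_cluster_sample:
  assumes A: "finite A" and C: "finite C" "C \<noteq> {}"
    and bad: "202 * (\<Sum>x\<in>A. sqd d x c) < (\<Sum>x\<in>A. dsq d x C)"
  shows "(\<Sum>x\<in>A. dsq d x C) / 8 \<le>
    (\<Sum>x | x \<in> A \<and> (\<Sum>y\<in>A. dsq d y (insert x C)) \<le> 202 * (\<Sum>y\<in>A. sqd d y c). dsq d x C)"
proof -
  define opt where "opt = (\<Sum>x\<in>A. sqd d x c)"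
  define a where "a = real (card A)"
  define W where "W = dsq d c C"
  define B where "B = {x \<in> A. a * sqd d x c \<le> 4 * opt}"
  have opt: "0 \<le> opt"
    by (simp add: opt_def sum_nonneg)
  have "A \<noteq> {}"
    using bad by auto
  then have a: "0 < a"
    using A by (simp add: a_def card_gt_0_iff)
  have B: "finite B" "B \<subseteq> A"
    using A by (auto simp: B_def)
  have phi_le: "(\<Sum>x\<in>A. dsq d x C) \<le> 2 * opt + 2 * (a * W)"
  proof -
    have "(\<Sum>x\<in>A. dsq d x C) \<le> (\<Sum>x\<in>A. 2 * sqd d x c + 2 * W)"
      unfolding W_def by (intro sum_mono dsq_triangle C)
    then show ?thesis
      by (simp add: sum.distrib opt_def a_def flip: sum_distrib_left)
  qed
  \<comment> \<open>This is where 202 comes from: 202 opt < 2 opt + 2 a W.\<close>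
  then have aW: "100 * opt < a * W"
    using bad by (simp add: opt_def)
  have card_B: "3 / 4 * a \<le> real (card B)"
  proof -
    have cardAB: "real (card (A - B)) = a - real (card B)"
      using A B by (simp add: a_def card_Diff_subset card_mono of_nat_diff)
    show ?thesis
    proof (cases "opt = 0")
      case True
      then have "sqd d x c = 0" if "x \<in> A" for x
        using A that by (simp add: opt_def sum_nonneg_eq_0_iff)
      then have "B = A"
        using True by (auto simp: B_def)
      then show ?thesis
        using a by (simp add: a_def)
    next
      case False
      have "real (card (A - B)) * (4 * opt) \<le> (\<Sum>x\<in>A - B. a * sqd d x c)"
        by (rule sum_bounded_below) (auto simp: B_def)
      also have "\<dots> \<le> (\<Sum>x\<in>A. a * sqd d x c)"
        using A a by (intro sum_mono2) auto
      also have "\<dots> = a * opt"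
        by (simp add: opt_def sum_distrib_left)
      finally have "(4 * real (card (A - B))) * opt \<le> a * opt"
        by simp
      then have "4 * real (card (A - B)) \<le> a"
        using False opt by (simp add: mult_le_cancel_right)
      then show ?thesis
        using cardAB by simp
    qed
  qed
  \<comment> \<open>On \<open>B\<close> the triangle inequality gives a W <= 8 opt + 2 a
    \<open>dsq d x C\<close>, and 8 opt <= 0.08 a W, which leaves 0.92 / 2.\<close>
  have "0.46 * (a * W) \<le> a * dsq d x C" if "x \<in> B" for x
  proof -
    have "a * W \<le> a * (2 * sqd d x c + 2 * dsq d x C)"
      unfolding W_def using dsq_triangle[OF C, of d c x] a by (intro mult_left_mono) (auto simp: sqd_commute)
    moreover have "a * sqd d x c \<le> 4 * opt"
      using that by (simp add: B_def)
    ultimately show ?thesis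
      using aW by (simp add: algebra_simps)
  qed
  then have "real (card B) * (0.46 * (a * W)) \<le> (\<Sum>x\<in>B. a * dsq d x C)"
    by (intro sum_bounded_below)
  moreover have "3 / 4 * a * (0.46 * (a * W)) \<le> real (card B) * (0.46 * (a * W))"
    using card_B aW opt by (intro mult_right_mono) auto
  ultimately have "3 / 4 * a * (0.46 * (a * W)) \<le> a * (\<Sum>x\<in>B. dsq d x C)"
    unfolding sum_distrib_left by (rule order_trans[rotated])
  then have "a * (0.345 * (a * W)) \<le> a * (\<Sum>x\<in>B. dsq d x C)"
    by (simp add: mult.assoc mult.left_commute)
  then have "0.345 * (a * W) \<le> (\<Sum>x\<in>B. dsq d x C)"
    using a by simp
  \<comment> \<open>The whole cluster weighs at most 2.02 a W, by \<open>phi_le\<close> and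
    \<open>aW\<close>; an eighth of this is below 0.345 a W.\<close>
  then have "(\<Sum>x\<in>A. dsq d x C) / 8 \<le> (\<Sum>x\<in>B. dsq d x C)"
    using phi_le aW opt by simp
  also have "\<dots> \<le> (\<Sum>x | x \<in> A \<and> (\<Sum>y\<in>A. dsq d y (insert x C)) \<le> 202 * opt. dsq d x C)"
  proof (rule sum_mono2)
    show "B \<subseteq> {x. x \<in> A \<and> (\<Sum>y\<in>A. dsq d y (insert x C)) \<le> 202 * opt}"
    proof clarify
      fix x assume x: "x \<in> B"
      \<comment> \<open>A draw from \<open>B\<close> brings the cluster down to 2 opt + 8 opt, far
        below the threshold.\<close>
      have "(\<Sum>y\<in>A. dsq d y (insert x C)) \<le> (\<Sum>y\<in>A. 2 * sqd d y c + 2 * sqd d x c)"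
      proof (rule sum_mono)
        fix y
        have "dsq d y (insert x C) \<le> sqd d y x"
          using C by (intro dsq_le_sqd) auto
        also have "\<dots> \<le> 2 * sqd d y c + 2 * sqd d x c"
          using sqd_triangle[of d y x c] by (simp add: sqd_commute)
        finally show "dsq d y (insert x C) \<le> 2 * sqd d y c + 2 * sqd d x c" .
      qed
      also have "\<dots> = 2 * opt + 2 * (a * sqd d x c)"
        by (simp add: sum.distrib opt_def a_def flip: sum_distrib_left)
      also have "\<dots> \<le> 202 * opt"
        using x opt by (simp add: B_def)
      finally show "x \<in> A \<and> (\<Sum>y\<in>A. dsq d y (insert x C)) \<le> 202 * opt"
        using x B by auto
    qed
  qed (use A in auto)
  finally show ?thesis
    by (simp add: opt_def)
qed

section \<open>Sampling against a fixed reference clustering\<close>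

locale clustering =
  fixes d :: nat and P :: "point set" and g :: "point \<Rightarrow> point"
  assumes finite_P: "finite P" and P_space: "P \<subseteq> topspace (Euclidean_space d)" and P_ne: "P \<noteq> {}"
begin

text \<open>The map \<open>g\<close> is any assignment to reference centres, not necessarily to the
  nearest one, so that outliers can later be their own centres. Clusters are its fibres.\<close>

definition cluster :: "point \<Rightarrow> point set" where
  "cluster j = {x \<in> P. g x = j}"

definition copt :: "point \<Rightarrow> real" where
  "copt j = (\<Sum>x\<in>cluster j. sqd d x j)"

text \<open>The cost of the reference assignment, as opposed to the infimum
  \<open>Opt\<close>.\<close>

definition opt :: real where
  "opt = (\<Sum>x\<in>P. sqd d x (g x))"

definition phi :: "point set \<Rightarrow> real" where
  "phi C = (\<Sum>x\<in>P. dsq d x C)"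

definition bad :: "point set \<Rightarrow> point set" where
  "bad C = {j \<in> g ` P. 202 * copt j < (\<Sum>x\<in>cluster j. dsq d x C)}"

lemma finite_cluster [simp]: "finite (cluster j)"
  using finite_P by (simp add: cluster_def)

lemma finite_bad [simp]: "finite (bad C)"
  using finite_P by (simp add: bad_def)

lemma sum_clusters: "(\<Sum>x\<in>P. f x) = (\<Sum>j\<in>g ` P. \<Sum>x\<in>cluster j. f x)"
  unfolding cluster_def by (rule sum.image_gen[OF finite_P])

lemma opt_eq: "opt = (\<Sum>j\<in>g ` P. copt j)"
  unfolding opt_def sum_clusters copt_def by (intro sum.cong) (auto simp: cluster_def)

lemma copt_nonneg: "0 \<le> copt j"
  by (simp add: copt_def sum_nonneg)

lemma opt_nonneg: "0 \<le> opt"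
  by (simp add: opt_def sum_nonneg)

text \<open>Consequently the number of bad clusters cannot grow during sampling.\<close>

lemma bad_antimono:
  assumes "finite C" "B \<subseteq> C" "B \<noteq> {}"
  shows "bad C \<subseteq> bad B"
proof
  fix j assume "j \<in> bad C"
  moreover have "(\<Sum>x\<in>cluster j. dsq d x C) \<le> (\<Sum>x\<in>cluster j. dsq d x B)"
    using assms by (intro sum_mono dsq_antimono)
  ultimately show "j \<in> bad B"
    by (auto simp: bad_def)
qed

lemma phi_antimono:
  assumes "finite C" "B \<subseteq> C" "B \<noteq> {}"
  shows "phi C \<le> phi B"
  unfolding phi_def using assms by (intro sum_mono dsq_antimono)

text \<open>Clusters that are not bad cost at most 202 opt together, less than half of the current
  cost. So the bad clusters carry at least half of the sampling weight, and by
  \<open>expensive_cluster_sample\<close> an eighth of that weight repairs the cluster drawn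
  from.\<close>

lemma expectation_bad_step:
  assumes ys: "ys \<noteq> []" "set ys \<subseteq> P" and unf: "404 * opt < phi (set ys)"
  shows "measure_pmf.expectation (d2_next d P ys) (\<lambda>y. real (card (bad (insert y (set ys)))))
    \<le> real (card (bad (set ys))) - 1 / 16"
proof -
  define C where "C = set ys"
  define b where "b = real (card (bad C))"
  define G where "G j = {x. x \<in> cluster j \<and> (\<Sum>y\<in>cluster j. dsq d y (insert x C)) \<le> 202 * copt j}" for j
  \<comment> \<open>\<open>H\<close> consists of the draws that make their own, hitherto bad,
    cluster cheap.\<close>
  define H where "H = {y \<in> P. g y \<in> bad C \<and> y \<in> G (g y)}"
  have C: "finite C" "C \<noteq> {}"
    using ys by (auto simp: C_def)
  have pos: "0 < phi C"
    using unf opt_nonneg by (simp add: C_def)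
  have nsub: "\<not> P \<subseteq> set ys"
  proof
    assume "P \<subseteq> set ys"
    then have "phi C = 0"
      unfolding phi_def C_def by (intro sum.neutral) (auto intro!: dsq_eq_0)
    then show False
      using pos by simp
  qed
  have pmf: "pmf (d2_next d P ys) x = (if x \<in> P then dsq d x C / phi C else 0)" for x
    unfolding C_def phi_def by (rule pmf_d2_next(2)[OF finite_P P_space ys nsub])
  have sum1: "(\<Sum>x\<in>P. dsq d x C / phi C) = 1"
    using pos by (simp add: phi_def flip: sum_divide_distrib)
  have card_le: "real (card (bad (insert y C))) \<le> b - (if y \<in> H then 1 else 0)" for y
  proof -
    have sub: "bad (insert y C) \<subseteq> bad C"
      using C by (intro bad_antimono) auto
    show ?thesis
    proof (cases "y \<in> H")
      case True
      then have "g y \<in> bad C" "g y \<notin> bad (insert y C)"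
        by (auto simp: H_def G_def bad_def)
      then have "card (bad (insert y C)) < card (bad C)"
        using sub by (intro psubset_card_mono) auto
      then show ?thesis
        using True by (simp add: b_def)
    next
      case False
      then show ?thesis
        using sub by (simp add: b_def card_mono)
    qed
  qed
  have "phi C / 16 \<le> (\<Sum>x\<in>H. dsq d x C)"
  proof -
    have "(\<Sum>j\<in>g ` P - bad C. \<Sum>x\<in>cluster j. dsq d x C) \<le> (\<Sum>j\<in>g ` P - bad C. 202 * copt j)"
      by (intro sum_mono) (auto simp: bad_def)
    also have "\<dots> \<le> (\<Sum>j\<in>g ` P. 202 * copt j)"
      using finite_P by (intro sum_mono2) (auto simp: copt_nonneg)
    also have "\<dots> \<le> phi C / 2"
      using unf by (simp add: opt_eq C_def flip: sum_distrib_left)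
    finally have "phi C / 2 \<le> (\<Sum>j\<in>bad C. \<Sum>x\<in>cluster j. dsq d x C)"
      using sum_clusters[of "\<lambda>x. dsq d x C"] finite_P
        sum.subset_diff[of "bad C" "g ` P" "\<lambda>j. \<Sum>x\<in>cluster j. dsq d x C"]
      by (auto simp: phi_def bad_def)
    then have "phi C / 16 \<le> (\<Sum>j\<in>bad C. (\<Sum>x\<in>cluster j. dsq d x C) / 8)"
      by (simp flip: sum_divide_distrib)
    also have "\<dots> \<le> (\<Sum>j\<in>bad C. \<Sum>x\<in>G j. dsq d x C)"
      unfolding G_def copt_def
      by (intro sum_mono expensive_cluster_sample) (auto simp: C bad_def copt_def)
    also have "\<dots> = (\<Sum>j\<in>bad C. \<Sum>x | x \<in> H \<and> g x = j. dsq d x C)"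
      by (intro sum.cong) (auto simp: H_def G_def cluster_def)
    also have "\<dots> = (\<Sum>x\<in>H. dsq d x C)"
      using finite_P by (intro sum.group) (auto simp: H_def)
    finally show ?thesis .
  qed
  then have "1 / 16 \<le> (\<Sum>x\<in>H. dsq d x C) / phi C"
    using pos by (simp add: field_simps)
  also have "\<dots> = (\<Sum>x\<in>P. (if x \<in> H then 1 else 0) * (dsq d x C / phi C))"
    using finite_P unfolding sum_divide_distrib by (intro sum.mono_neutral_cong_left) (auto simp: H_def)
  finally have H: "1 / 16 \<le> (\<Sum>x\<in>P. (if x \<in> H then 1 else 0) * (dsq d x C / phi C))" .
  have "measure_pmf.expectation (d2_next d P ys) (\<lambda>y. real (card (bad (insert y C))))
      = (\<Sum>y\<in>P. real (card (bad (insert y C))) * (dsq d y C / phi C))"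
    by (subst integral_measure_pmf_real[where A = P]) (auto simp: finite_P pmf set_pmf_eq split: if_splits)
  also have "\<dots> \<le> (\<Sum>y\<in>P. (b - (if y \<in> H then 1 else 0)) * (dsq d y C / phi C))"
    using card_le pos by (intro sum_mono mult_right_mono) auto
  also have "\<dots> = b * (\<Sum>y\<in>P. dsq d y C / phi C)
      - (\<Sum>y\<in>P. (if y \<in> H then 1 else 0) * (dsq d y C / phi C))"
    unfolding left_diff_distrib sum_subtractf sum_distrib_left ..
  also have "\<dots> \<le> b - 1 / 16"
    using H sum1 by simp
  finally show ?thesis
    by (simp add: C_def b_def)
qed

text \<open>A supermartingale: after the first sample, its value at time \<open>n + 1\<close> does not exceed in
  expectation its value at time \<open>n\<close>, because each step taken while the cost is too high repairs a
  bad cluster with probability at least \<open>1/16\<close>.\<close>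

definition potential :: "nat \<Rightarrow> point list \<Rightarrow> real" where
  "potential n ys = real (card (bad (set ys))) + real n / 16 * (if 404 * opt < phi (set ys) then 1 else 0)"

text \<open>While the cost is high, the expected drop by 1/16 in the number of bad clusters pays for
  the coefficient rising from n/16 to (n+1)/16. Once the cost is at most 404 opt it stays so, and
  neither summand can grow.\<close>

lemma potential_step:
  assumes ys: "ys \<noteq> []" "set ys \<subseteq> P"
  shows "measure_pmf.expectation
     (if P \<subseteq> set ys then return_pmf ys else map_pmf (\<lambda>y. ys @ [y]) (d2_next d P ys))
     (potential (Suc n)) \<le> potential n ys"
proof (cases "404 * opt < phi (set ys)")
  case True
  have "\<not> P \<subseteq> set ys"
  proof
    assume "P \<subseteq> set ys"
    then have "phi (set ys) = 0"
      unfolding phi_def by (intro sum.neutral) (auto intro!: dsq_eq_0)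
    then show False
      using True opt_nonneg by simp
  qed
  then have fin: "finite (set_pmf (d2_next d P ys))"
    using set_pmf_d2_next[OF finite_P P_space ys(2)] finite_P finite_subset by blast
  have "measure_pmf.expectation (d2_next d P ys) (\<lambda>y. potential (Suc n) (ys @ [y]))
     \<le> measure_pmf.expectation (d2_next d P ys)
         (\<lambda>y. real (card (bad (insert y (set ys)))) + real (Suc n) / 16)"
    by (rule integral_mono) (auto simp: potential_def intro!: integrable_measure_pmf_finite fin)
  also have "\<dots> = measure_pmf.expectation (d2_next d P ys) (\<lambda>y. real (card (bad (insert y (set ys)))))
      + real (Suc n) / 16"
    by (subst Bochner_Integration.integral_add) (auto intro!: integrable_measure_pmf_finite fin)
  also have "\<dots> \<le> potential n ys"
    using expectation_bad_step[OF ys True] True by (simp add: potential_def field_simps)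
  finally show ?thesis
    using \<open>\<not> P \<subseteq> set ys\<close> by simp
next
  case False
  have le: "potential (Suc n) (ys @ [y]) \<le> potential n ys" for y
  proof -
    have sub: "bad (insert y (set ys)) \<subseteq> bad (set ys)"
      using ys by (intro bad_antimono) auto
    have "phi (insert y (set ys)) \<le> phi (set ys)"
      using ys by (intro phi_antimono) auto
    then show ?thesis
      using False card_mono[OF finite_bad sub] by (simp add: potential_def)
  qed
  show ?thesis
  proof (cases "P \<subseteq> set ys")
    case True
    then show ?thesis
      using False by (simp add: potential_def)
  next
    case nsub: False
    then have fin: "finite (set_pmf (d2_next d P ys))"
      using set_pmf_d2_next[OF finite_P P_space ys(2)] finite_P finite_subset by blast
    show ?thesis
      using nsub measure_pmf.integral_le_const[OF integrable_measure_pmf_finite[OF fin] AE_pmfI[OF le]]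
      by simp
  qed
qed

text \<open>The induction starts after the first, uniform draw, where the potential only counts bad
  clusters; hence \<open>n\<close> lags one behind the number of draws.\<close>

lemma expectation_potential:
  "measure_pmf.expectation (d2_sample d P (Suc n)) (potential n) \<le> real (card (g ` P))"
proof (induction n)
  case 0
  have "potential 0 ys \<le> real (card (g ` P))" for ys
    unfolding potential_def using finite_P by (auto simp: bad_def intro!: card_mono)
  then show ?case
    by (intro measure_pmf.integral_le_const AE_pmfI integrable_measure_pmf_finite
        finite_set_pmf_d2_sample finite_P P_space)
next
  case (Suc n)
  define S where "S = set_pmf (d2_sample d P (Suc n))"
  have S: "finite S"
    unfolding S_def by (rule finite_set_pmf_d2_sample[OF finite_P P_space])
  have inS: "ys \<noteq> []" "set ys \<subseteq> P" if "ys \<in> S" for ys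
    using set_pmf_d2_sample[OF finite_P P_space, of ys "Suc n"] P_ne that by (auto simp: S_def)
  have "measure_pmf.expectation (d2_sample d P (Suc (Suc n))) (potential (Suc n))
    = (\<Sum>ys\<in>S. pmf (d2_sample d P (Suc n)) ys *\<^sub>R measure_pmf.expectation
     (if P \<subseteq> set ys then return_pmf ys else map_pmf (\<lambda>y. ys @ [y]) (d2_next d P ys))
     (potential (Suc n)))"
    unfolding d2_sample.simps(2)[of d P "Suc n"]
  proof (rule pmf_expectation_bind[OF S])
    fix ys assume "ys \<in> S"
    then show "finite (set_pmf (if P \<subseteq> set ys then return_pmf ys
        else map_pmf (\<lambda>y. ys @ [y]) (d2_next d P ys)))"
      using finite_subset[OF set_pmf_d2_next[OF finite_P P_space inS(2)] finite_P] by auto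
  qed (simp add: S_def)
  also have "\<dots> \<le> (\<Sum>ys\<in>S. pmf (d2_sample d P (Suc n)) ys *\<^sub>R potential n ys)"
    using inS by (intro sum_mono scaleR_left_mono potential_step) auto
  also have "\<dots> = measure_pmf.expectation (d2_sample d P (Suc n)) (potential n)"
    by (rule integral_measure_pmf[symmetric, OF S]) (simp add: S_def)
  finally show ?case
    using Suc.IH by simp
qed

text \<open>A Markov-type bound: as long as the cost is too high, the potential is at least
  n/16.\<close>

lemma d2_sample_good:
  assumes "32 * card (g ` P) \<le> m"
  shows "15 / 31 \<le> measure_pmf.prob (d2_sample d P m) {ys. phi (set ys) \<le> 404 * opt}"
proof -
  define K where "K = card (g ` P)"
  have K: "1 \<le> K"
    using finite_P P_ne by (simp add: K_def Suc_le_eq card_gt_0_iff)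
  obtain n where n: "m = Suc n"
    using assms K by (cases m) (auto simp: K_def)
  let ?M = "d2_sample d P m"
  have int: "integrable (measure_pmf ?M) f" for f :: "_ \<Rightarrow> real"
    by (intro integrable_measure_pmf_finite finite_set_pmf_d2_sample finite_P P_space)
  have "real n / 16 * measure_pmf.prob ?M {ys. 404 * opt < phi (set ys)}
    = measure_pmf.expectation ?M (\<lambda>ys. real n / 16 * indicator {ys. 404 * opt < phi (set ys)} ys)"
    by simp
  also have "\<dots> \<le> measure_pmf.expectation ?M (potential n)"
    by (intro integral_mono int) (auto simp: potential_def indicator_def)
  also have "\<dots> \<le> K"
    using expectation_potential[of n] by (simp add: K_def n)
  finally have *: "real n * measure_pmf.prob ?M {ys. 404 * opt < phi (set ys)} \<le> 16 * real K"
    by simp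
  \<comment> \<open>One of the draws only starts the process, and 32 K - 1 >= 31 K because K >=
    1.\<close>
  have "31 * real K \<le> real n"
    using assms K n unfolding K_def[symmetric] by linarith
  then have "31 * real K * measure_pmf.prob ?M {ys. 404 * opt < phi (set ys)} \<le> 16 * real K"
    using * by (meson mult_right_mono measure_nonneg order_trans)
  then have "measure_pmf.prob ?M {ys. 404 * opt < phi (set ys)} \<le> 16 / 31"
    using K by (simp add: field_simps)
  moreover have "{ys. phi (set ys) \<le> 404 * opt} = - {ys. 404 * opt < phi (set ys)}"
    by auto
  ultimately show ?thesis
    using measure_pmf.prob_compl[of "{ys. 404 * opt < phi (set ys)}" ?M] by (simp add: Compl_eq_Diff_UNIV)
qed

end

section \<open>Coresets from \<open>D\<^sup>2\<close>-samples\<close>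

text \<open>With weights read as multiplicities, the output is the input with every point moved to
  its representative.\<close>

lemma weighted_mset_eq_image_mset:
  assumes "finite P" "finite Y" "t ` P \<subseteq> Y"
  shows "weighted_mset Y (\<lambda>y. card {x \<in> P. t x = y}) = image_mset t (mset_set P)"
proof (rule multiset_eqI)
  fix a
  have "count (weighted_mset Y (\<lambda>y. card {x \<in> P. t x = y})) a
      = (\<Sum>y\<in>Y. if y = a then card {x \<in> P. t x = y} else 0)"
    unfolding weighted_mset_def count_sum by (intro sum.cong) auto
  also have "\<dots> = card {x \<in> P. t x = a}"
    using assms by (auto simp: sum.delta' card_eq_0_iff)
  also have "\<dots> = count (image_mset t (mset_set P)) a"
    using assms(1) by (auto simp: count_image_mset intro!: arg_cong[where f = card])
  finally show "count (weighted_mset Y (\<lambda>y. card {x \<in> P. t x = y})) a = \<dots>" .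
qed

text \<open>The factors produced by the first property are fed into the second one, which accepts
  factors of at least 1 only; hence the bounds on \<open>\<alpha>1\<close> and
  \<open>\<beta>1\<close>.\<close>

lemma is_coreset_trans:
  assumes "is_coreset d k \<alpha>1 \<beta>1 Y z' S z'" "is_coreset d k \<alpha>2 \<beta>2 S z' X z" "1 \<le> \<alpha>1" "1 \<le> \<beta>1"
  shows "is_coreset d k (\<alpha>1 * \<alpha>2) (\<beta>1 * \<beta>2) Y z' X z"
  unfolding is_coreset_def
proof (intro ballI allI impI)
  fix C and \<kappa>1 \<kappa>2 :: real
  assume C: "C \<in> centers d k" and \<kappa>: "1 \<le> \<kappa>1" "1 \<le> \<kappa>2"
    and Y: "cost d Y (\<kappa>1 * z') C \<le> \<kappa>2 * Opt d Y k z'"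
  have "cost d S (\<alpha>1 * \<kappa>1 * z') C \<le> \<beta>1 * \<kappa>2 * Opt d S k z'"
    using assms(1) C \<kappa> Y by (auto simp: is_coreset_def)
  moreover have "1 \<le> \<alpha>1 * \<kappa>1" "1 \<le> \<beta>1 * \<kappa>2"
    using assms(3,4) \<kappa> mult_mono[of 1 \<alpha>1 1 \<kappa>1] mult_mono[of 1 \<beta>1 1 \<kappa>2] by auto
  ultimately have "cost d X (\<alpha>2 * (\<alpha>1 * \<kappa>1) * z) C \<le> \<beta>2 * (\<beta>1 * \<kappa>2) * Opt d X k z"
    using assms(2) C unfolding is_coreset_def by blast
  then show "cost d X (\<alpha>1 * \<alpha>2 * \<kappa>1 * z) C \<le> \<beta>1 * \<beta>2 * \<kappa>2 * Opt d X k z"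
    by (simp add: ac_simps)
qed

lemma is_coreset_mono:
  assumes "is_coreset d k \<alpha> \<beta> Y z' X z" "\<alpha> \<le> \<alpha>'" "\<beta> \<le> \<beta>'" "1 \<le> d" "1 \<le> k" "0 \<le> \<alpha>" "0 \<le> z"
  shows "is_coreset d k \<alpha>' \<beta>' Y z' X z"
  unfolding is_coreset_def
proof (intro ballI allI impI)
  fix C and \<kappa>1 \<kappa>2 :: real
  assume C: "C \<in> centers d k" and \<kappa>: "1 \<le> \<kappa>1" "1 \<le> \<kappa>2"
    and Y: "cost d Y (\<kappa>1 * z') C \<le> \<kappa>2 * Opt d Y k z'"
  have "0 \<le> \<alpha> * \<kappa>1 * z"
    using assms \<kappa> by simp
  then obtain Q where Q: "Q \<subseteq># X" "real (size (X - Q)) \<le> \<alpha> * \<kappa>1 * z"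
    "cost d X (\<alpha> * \<kappa>1 * z) C = (\<Sum>x\<in>#Q. dsq d x C)"
    by (rule cost_attained)
  have "\<alpha> * \<kappa>1 * z \<le> \<alpha>' * \<kappa>1 * z"
    using assms \<kappa> by (intro mult_right_mono) auto
  then have "cost d X (\<alpha>' * \<kappa>1 * z) C \<le> cost d X (\<alpha> * \<kappa>1 * z) C"
    using Q cost_le[OF centersD[OF C assms(5)] Q(1), of "\<alpha>' * \<kappa>1 * z"] by simp
  also have "\<dots> \<le> \<beta> * \<kappa>2 * Opt d X k z"
    using assms(1) C \<kappa> Y by (auto simp: is_coreset_def)
  also have "\<dots> \<le> \<beta>' * \<kappa>2 * Opt d X k z"
    using assms \<kappa> Opt_nonneg[of d X k z] by (intro mult_right_mono) auto
  finally show "cost d X (\<alpha>' * \<kappa>1 * z) C \<le> \<beta>' * \<kappa>2 * Opt d X k z" .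
qed

text \<open>Moving the points changes costs, in both directions, by a factor 2 and an additive 2 B
  Opt. Copies correspond to points, so the outlier budget is preserved. The constant is 2 B + 2 (2 B
  + 4).\<close>

lemma is_coreset_image_mset:
  assumes dk: "1 \<le> d" "1 \<le> k" and P: "finite P" "P \<subseteq> topspace (Euclidean_space d)" and "0 \<le> z" "0 \<le> B"
    and phi: "(\<Sum>x\<in>P. sqd d x (t x)) \<le> B * Opt d (mset_set P) k z"
  shows "is_coreset d k 1 (6 * B + 8) (image_mset t (mset_set P)) z (mset_set P) z"
  unfolding is_coreset_def
proof (intro ballI allI impI)
  fix C and \<kappa>1 \<kappa>2 :: real
  assume C: "C \<in> centers d k" and \<kappa>: "1 \<le> \<kappa>1" "1 \<le> \<kappa>2"
    and le: "cost d (image_mset t (mset_set P)) (\<kappa>1 * z) C \<le> \<kappa>2 * Opt d (image_mset t (mset_set P)) k z"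
  define OP where "OP = Opt d (mset_set P) k z"
  let ?Y = "image_mset t (mset_set P)"
  have OP: "0 \<le> OP"
    using dk by (simp add: OP_def Opt_nonneg)
  note Cf = centersD[OF C dk(2)]
  have part: "(\<Sum>x\<in>Q. sqd d x (t x)) \<le> B * OP" if "Q \<subseteq> P" for Q
    using sum_mono2[OF P(1) that, of "\<lambda>x. sqd d x (t x)"] phi by (simp add: OP_def)
  have "Opt d ?Y k z \<le> (2 * B + 4) * OP"
  proof -
    obtain D where D: "D \<in> centers d k" "cost d (mset_set P) z D \<le> 2 * OP"
      using near_optimal_centers[OF dk P \<open>0 \<le> z\<close>] unfolding OP_def by blast
    note Df = centersD[OF D(1) dk(2)]
    obtain Q where Q: "Q \<subseteq> P" "real (card (P - Q)) \<le> z" "cost d (mset_set P) z D = (\<Sum>x\<in>Q. dsq d x D)"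
      using cost_set_attained[OF P(1) \<open>0 \<le> z\<close>] by metis
    have sub: "mset_set Q \<subseteq># mset_set P"
      using P Q by (simp add: subset_imp_msubset_mset_set)
    have "Opt d ?Y k z \<le> cost d ?Y z D"
      by (rule Opt_le[OF D(1)])
    also have "\<dots> \<le> (\<Sum>y\<in>#image_mset t (mset_set Q). dsq d y D)"
    proof (rule cost_le[OF Df])
      show "image_mset t (mset_set Q) \<subseteq># ?Y"
        by (rule image_mset_subseteq_mono[OF sub])
      have "?Y - image_mset t (mset_set Q) = image_mset t (mset_set (P - Q))"
        using P Q sub by (simp add: image_mset_Diff mset_set_Diff)
      then show "real (size (?Y - image_mset t (mset_set Q))) \<le> z"
        using Q by simp
    qed
    also have "\<dots> = (\<Sum>x\<in>Q. dsq d (t x) D)"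
      by (simp add: sum_unfold_sum_mset multiset.map_comp comp_def)
    also have "\<dots> \<le> (\<Sum>x\<in>Q. 2 * sqd d x (t x) + 2 * dsq d x D)"
      by (intro sum_mono) (metis dsq_triangle[OF Df] sqd_commute)
    also have "\<dots> = 2 * (\<Sum>x\<in>Q. sqd d x (t x)) + 2 * (\<Sum>x\<in>Q. dsq d x D)"
      by (simp add: sum.distrib sum_distrib_left)
    also have "\<dots> \<le> 2 * (B * OP) + 2 * (2 * OP)"
      using part[OF Q(1)] D(2) Q(3) by simp
    finally show ?thesis
      by (simp add: algebra_simps)
  qed
  then have "\<kappa>2 * Opt d ?Y k z \<le> \<kappa>2 * ((2 * B + 4) * OP)"
    using \<kappa> by (intro mult_left_mono) auto
  note le' = order_trans[OF le this]
  have "0 \<le> \<kappa>1 * z"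
    using \<kappa> \<open>0 \<le> z\<close> by simp
  then obtain T where T: "T \<subseteq># ?Y" "real (size (?Y - T)) \<le> \<kappa>1 * z" "cost d ?Y (\<kappa>1 * z) C = (\<Sum>y\<in>#T. dsq d y C)"
    by (rule cost_attained)
  \<comment> \<open>The kept copies are lifted to kept points of \<open>P\<close>; which preimages
    of a location are taken does not matter.\<close>
  obtain N where N: "N \<subseteq># mset_set P" "T = image_mset t N"
  proof -
    have "?Y = T + (?Y - T)"
      using T(1) by simp
    then obtain N N' where "mset_set P = N + N'" "T = image_mset t N"
      by (metis image_mset_eq_plusD)
    then show ?thesis
      using that[of N] by simp
  qed
  define R where "R = set_mset N"
  have R: "N = mset_set R" "R \<subseteq> P"
    using subset_mset_mset_set[OF P(1) N(1)] by (auto simp: R_def)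
  have "?Y - T = image_mset t (mset_set (P - R))"
    using P R N by (simp add: image_mset_Diff mset_set_Diff)
  then have "real (card (P - R)) \<le> \<kappa>1 * z"
    using T(2) by simp
  then have "cost d (mset_set P) (\<kappa>1 * z) C \<le> (\<Sum>x\<in>R. dsq d x C)"
    using R P Cf by (intro cost_set_le) auto
  also have "\<dots> \<le> (\<Sum>x\<in>R. 2 * sqd d x (t x) + 2 * dsq d (t x) C)"
    by (intro sum_mono dsq_triangle Cf)
  also have "\<dots> = 2 * (\<Sum>x\<in>R. sqd d x (t x)) + 2 * (\<Sum>x\<in>R. dsq d (t x) C)"
    by (simp add: sum.distrib sum_distrib_left)
  also have "(\<Sum>x\<in>R. dsq d (t x) C) = cost d ?Y (\<kappa>1 * z) C"
    unfolding T(3) N(2) R(1) by (simp add: sum_unfold_sum_mset multiset.map_comp comp_def)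
  also have "2 * (\<Sum>x\<in>R. sqd d x (t x)) + 2 * cost d ?Y (\<kappa>1 * z) C
      \<le> 2 * (\<kappa>2 * (B * OP)) + 2 * (\<kappa>2 * ((2 * B + 4) * OP))"
  proof -
    \<comment> \<open>The additive error is absorbed into the multiplicative one because
      \<open>\<kappa>2\<close> is at least 1.\<close>
    have "B * OP \<le> \<kappa>2 * (B * OP)"
      using \<kappa> OP \<open>0 \<le> B\<close> mult_right_mono[of 1 \<kappa>2 "B * OP"] by simp
    then show ?thesis
      using part[OF R(2)] le' by linarith
  qed
  finally show "cost d (mset_set P) (1 * \<kappa>1 * z) C \<le> (6 * B + 8) * \<kappa>2 * Opt d (mset_set P) k z"
    unfolding OP_def[symmetric] by (simp add: algebra_simps)
qed

lemma optimal_clustering: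
  assumes dk: "1 \<le> d" "1 \<le> k" and X: "finite X" "X \<subseteq> topspace (Euclidean_space d)" and z: "0 \<le> z"
  obtains C Q g where "C \<in> centers d k" "Q \<subseteq> X" "real (card (X - Q)) \<le> z" "\<And>x. g x \<in> C"
    "\<And>x. dsq d x C = sqd d x (g x)" "(\<Sum>x\<in>Q. sqd d x (g x)) \<le> 2 * Opt d (mset_set X) k z"
proof -
  obtain C where C: "C \<in> centers d k" "cost d (mset_set X) z C \<le> 2 * Opt d (mset_set X) k z"
    using near_optimal_centers[OF dk X z] by blast
  note Cf = centersD[OF C(1) dk(2)]
  obtain Q where Q: "Q \<subseteq> X" "real (card (X - Q)) \<le> z" "cost d (mset_set X) z C = (\<Sum>x\<in>Q. dsq d x C)"
    using cost_set_attained[OF X(1) z] by metis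
  have "\<forall>x. \<exists>c. c \<in> C \<and> dsq d x C = sqd d x c"
    using dsq_attained[OF Cf] by metis
  then obtain g where "\<And>x. g x \<in> C" "\<And>x. dsq d x C = sqd d x (g x)"
    by metis
  then show ?thesis
    using that[OF C(1) Q(1,2), of g] C(2) Q(3) by simp
qed

text \<open>The reference solution for the sampled centres consists of near-optimal centres together with
  one centre for each outlier; it has \<open>k + \<lfloor>z\<rfloor>\<close> centres and no outliers.\<close>

lemma kmeanspp_coreset:
  assumes dk: "1 \<le> d" "1 \<le> k" and P: "finite P" "P \<subseteq> topspace (Euclidean_space d)" and z: "0 \<le> z"
    and m: "32 * (k + nat \<lfloor>z\<rfloor>) \<le> m" and \<tau>: "closest_rule d \<tau>"
  shows "15 / 31 \<le> measure_pmf.prob (kmeanspp d \<tau> P m)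
    {(Y, w). is_coreset d k 1 4856 (weighted_mset Y w) z (mset_set P) z}"
proof (cases "P = {}")
  \<comment> \<open>An empty instance can really occur, since a random subsample may be
    empty.\<close>
  case True
  have "cost d {#} r C = 0" for r C
    using trimmed_subset[of d "{#}" r C] by (simp add: cost_def)
  then have "is_coreset d k 1 4856 Y z (mset_set P) z" for Y
    using True Opt_nonneg[of d "{#}" k z] dk by (auto simp: is_coreset_def)
  then show ?thesis
    by simp
next
  case False
  obtain C Q h where C: "C \<in> centers d k" and Q: "Q \<subseteq> P" "real (card (P - Q)) \<le> z"
    and h: "\<And>x. h x \<in> C" "(\<Sum>x\<in>Q. sqd d x (h x)) \<le> 2 * Opt d (mset_set P) k z"
    using optimal_clustering[OF dk P z] by metis
  \<comment> \<open>Kept points go to their near-optimal centre; each outlier is its own centre, at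
    no cost.\<close>
  define g where "g x = (if x \<in> Q then h x else x)" for x
  interpret clustering d P g
    by unfold_locales (use P False in auto)
  have "card (g ` P) \<le> card (C \<union> (P - Q))"
    using centersD[OF C dk(2)] P h by (intro card_mono) (auto simp: g_def)
  also have "\<dots> \<le> k + card (P - Q)"
    using card_Un_le[of C "P - Q"] C by (simp add: centers_def)
  also have "\<dots> \<le> k + nat \<lfloor>z\<rfloor>"
    using Q(2) by linarith
  finally have "32 * card (g ` P) \<le> m"
    using m by (meson mult_le_mono2 order_trans)
  then have "15 / 31 \<le> measure_pmf.prob (d2_sample d P m) {ys. phi (set ys) \<le> 404 * opt}"
    by (rule d2_sample_good)
  also have "\<dots> \<le> measure_pmf.prob (d2_sample d P m)
    {ys. is_coreset d k 1 4856 (weighted_mset (set ys) (\<lambda>y. card {x \<in> P. \<tau> ys x = y})) z (mset_set P) z}"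
  proof (rule measure_pmf.finite_measure_mono_AE)
    have "is_coreset d k 1 4856 (weighted_mset (set ys) (\<lambda>y. card {x \<in> P. \<tau> ys x = y})) z (mset_set P) z"
      if ys: "ys \<in> set_pmf (d2_sample d P m)" and small: "phi (set ys) \<le> 404 * opt" for ys
    proof -
      have "set ys \<subseteq> P" "ys \<noteq> []"
        using set_pmf_d2_sample[OF P ys] False m dk by auto
      then have t: "\<tau> ys x \<in> set ys" "sqd d x (\<tau> ys x) = dsq d x (set ys)" if "x \<in> P" for x
        using \<tau> P that by (auto simp: closest_rule_def sqd_def dsq_def subset_iff)
      have opt_le: "opt \<le> 2 * Opt d (mset_set P) k z"
      proof -
        have "opt = (\<Sum>x\<in>Q. sqd d x (h x))"
          unfolding opt_def using P Q by (intro sum.mono_neutral_cong_right) (auto simp: g_def)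
        then show ?thesis
          using h by simp
      qed
      have "(\<Sum>x\<in>P. sqd d x (\<tau> ys x)) = phi (set ys)"
        by (simp add: phi_def t)
      also have "\<dots> \<le> 808 * Opt d (mset_set P) k z"
        using small opt_le by linarith
      \<comment> \<open>Here 808 = 2 * 404, with the 2 due to near-optimality, and 6 * 808 + 8 =
        4856.\<close>
      finally have "is_coreset d k 1 (6 * 808 + 8) (image_mset (\<tau> ys) (mset_set P)) z (mset_set P) z"
        by (intro is_coreset_image_mset dk P z) auto
      moreover have "weighted_mset (set ys) (\<lambda>y. card {x \<in> P. \<tau> ys x = y}) = image_mset (\<tau> ys) (mset_set P)"
        using P t by (intro weighted_mset_eq_image_mset) auto
      ultimately show ?thesis
        by simp
    qed
    then show "AE ys in d2_sample d P m. ys \<in> {ys. phi (set ys) \<le> 404 * opt} \<longrightarrow>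
      ys \<in> {ys. is_coreset d k 1 4856 (weighted_mset (set ys) (\<lambda>y. card {x \<in> P. \<tau> ys x = y})) z (mset_set P) z}"
      by (auto simp: AE_measure_pmf_iff)
  qed simp
  finally show ?thesis
    by (simp add: kmeanspp_def vimage_def)
qed

section \<open>Uniform sampling\<close>

lemma sum_fibres:
  assumes "finite Q" "finite J"
  shows "(\<Sum>j\<in>J. \<Sum>x | x \<in> Q \<and> g x = j. f x) = (\<Sum>x | x \<in> Q \<and> g x \<in> J. f x)"
proof -
  have "(\<Sum>j\<in>J. \<Sum>x | x \<in> Q \<and> g x = j. f x) = (\<Sum>j\<in>J. \<Sum>x | x \<in> {x \<in> Q. g x \<in> J} \<and> g x = j. f x)"
    by (intro sum.cong) auto
  also have "\<dots> = (\<Sum>x | x \<in> Q \<and> g x \<in> J. f x)"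
    using assms by (intro sum.group) auto
  finally show ?thesis .
qed

lemma sum_card_fibres:
  assumes "finite Q" "finite J"
  shows "(\<Sum>j\<in>J. real (card {x \<in> Q. g x = j})) = real (card {x \<in> Q. g x \<in> J})"
  using sum_fibres[OF assms, where g = g and f = "\<lambda>_. 1 :: real"] by simp

text \<open>Every point of \<open>A\<close> is compared with the average over \<open>T\<close>, both routed through \<open>c\<close>.\<close>

lemma sum_dsq_le_by_sample:
  assumes "finite D" "D \<noteq> {}" "finite T" "T \<noteq> {}" "0 < p" and T: "p * real (card A) / 8 \<le> real (card T)"
  shows "(\<Sum>x\<in>A. dsq d x D) \<le>
    4 * (\<Sum>x\<in>A. sqd d x c) + 8 / p * (4 * (\<Sum>s\<in>T. sqd d s c) + 2 * (\<Sum>s\<in>T. dsq d s D))"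
proof -
  define W where "W = 4 * (\<Sum>s\<in>T. sqd d s c) + 2 * (\<Sum>s\<in>T. dsq d s D)"
  have W: "0 \<le> W"
    by (simp add: W_def sum_nonneg)
  have cT: "0 < real (card T)"
    using assms by (simp add: card_gt_0_iff)
  have "dsq d x D \<le> 4 * sqd d x c + W / real (card T)" for x
  proof -
    have "real (card T) * dsq d x D = (\<Sum>s\<in>T. dsq d x D)"
      by simp
    also have "\<dots> \<le> (\<Sum>s\<in>T. 4 * sqd d x c + (4 * sqd d s c + 2 * dsq d s D))"
    proof (rule sum_mono)
      fix s
      show "dsq d x D \<le> 4 * sqd d x c + (4 * sqd d s c + 2 * dsq d s D)"
        using dsq_triangle[OF assms(1,2), of d x s] sqd_triangle[of d x s c] by (simp add: sqd_commute)
    qed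
    also have "\<dots> = real (card T) * (4 * sqd d x c) + W"
      by (simp add: W_def sum.distrib sum_distrib_left)
    finally show ?thesis
      using cT by (simp add: field_simps)
  qed
  then have "(\<Sum>x\<in>A. dsq d x D) \<le> (\<Sum>x\<in>A. 4 * sqd d x c + W / real (card T))"
    by (intro sum_mono)
  also have "\<dots> = 4 * (\<Sum>x\<in>A. sqd d x c) + real (card A) / real (card T) * W"
    by (simp add: sum.distrib sum_distrib_left)
  also have "real (card A) / real (card T) * W \<le> 8 / p * W"
    using T cT W assms(5) by (intro mult_right_mono) (simp_all add: field_simps)
  finally show ?thesis
    by (simp add: W_def)
qed

text \<open>The deterministic part: \<open>S_out\<close>, \<open>S_cost\<close> and
  \<open>S_large\<close> mention the reference solution only and still imply the bound for every
  \<open>D\<close>, so no union bound over centre sets arises.\<close>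

lemma is_coreset_subsample:
  fixes p :: real and k z :: nat
  assumes dk: "1 \<le> d" "1 \<le> k" and X: "finite X" and z: "1 \<le> z" and p: "0 < p"
    and C: "C \<in> centers d k" and Q: "Q \<subseteq> X" "card (X - Q) \<le> z"
    and g: "\<And>x. g x \<in> C" "\<And>x. dsq d x C = sqd d x (g x)"
    and opt: "(\<Sum>x\<in>Q. sqd d x (g x)) \<le> 2 * Opt d (mset_set X) k z"
    and S: "S \<subseteq> X"
    and S_out: "real (card (S \<inter> (X - Q))) \<le> 2.5 * p * real z"
    and S_cost: "(\<Sum>x\<in>S \<inter> Q. sqd d x (g x)) \<le> 4 * (p * (\<Sum>x\<in>Q. sqd d x (g x)))"
    and S_large: "\<And>j. \<lbrakk>j \<in> C; real z \<le> real k * real (card {x \<in> Q. g x = j})\<rbrakk> \<Longrightarrow>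
       p * real (card {x \<in> Q. g x = j}) / 4 \<le> real (card (S \<inter> {x \<in> Q. g x = j}))"
  shows "is_coreset d k 22 392 (mset_set S) (2.5 * p * real z) (mset_set X) (real z)"
  unfolding is_coreset_def
proof (intro ballI allI impI)
  fix D and \<kappa>1 \<kappa>2 :: real
  define z' where "z' = 2.5 * p * real z"
  assume D: "D \<in> centers d k" and \<kappa>: "1 \<le> \<kappa>1" "1 \<le> \<kappa>2"
    and "cost d (mset_set S) (\<kappa>1 * (2.5 * p * real z)) D \<le> \<kappa>2 * Opt d (mset_set S) k (2.5 * p * real z)"
  then have le: "cost d (mset_set S) (\<kappa>1 * z') D \<le> \<kappa>2 * Opt d (mset_set S) k z'"
    by (simp add: z'_def)
  note Cf = centersD[OF C dk(2)] and Df = centersD[OF D dk(2)]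
  have fin: "finite S" "finite Q"
    using X S Q finite_subset by auto
  define c where "c = (\<Sum>x\<in>Q. sqd d x (g x))"
  have c: "0 \<le> c"
    by (simp add: c_def sum_nonneg)
  define A where "A j = {x \<in> Q. g x = j}" for j
  have finA [simp]: "finite (A j)" for j
    using fin by (simp add: A_def)
  have z': "0 \<le> z'"
    using p by (simp add: z'_def)

  have "Opt d (mset_set S) k z' \<le> cost d (mset_set S) z' C"
    by (rule Opt_le[OF C])
  also have "\<dots> \<le> (\<Sum>x\<in>S \<inter> Q. dsq d x C)"
  proof (rule cost_set_le[OF Cf fin(1)])
    have "S - S \<inter> Q = S \<inter> (X - Q)"
      using S by auto
    then show "real (card (S - S \<inter> Q)) \<le> z'"
      using S_out by (simp add: z'_def)
  qed auto
  also have "\<dots> \<le> 4 * (p * c)"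
    using S_cost by (simp add: g(2) c_def)
  finally have "\<kappa>2 * Opt d (mset_set S) k z' \<le> \<kappa>2 * (4 * (p * c))"
    using \<kappa> by (intro mult_left_mono) auto
  note le' = order_trans[OF le this]
  have "0 \<le> \<kappa>1 * z'"
    using \<kappa> z' by simp
  then obtain R where R: "R \<subseteq> S" "real (card (S - R)) \<le> \<kappa>1 * z'"
    "cost d (mset_set S) (\<kappa>1 * z') D = (\<Sum>x\<in>R. dsq d x D)"
    using cost_set_attained[OF fin(1)] by metis
  have finR: "finite R"
    using R fin finite_subset by auto

  \<comment> \<open>\<open>L\<close> holds the clusters with at least z / k points, and
    \<open>T\<close> the sample points of a cluster that \<open>D\<close> does not discard. A
    cluster of \<open>L\<close> is in \<open>G\<close> if \<open>T\<close> retains half of the p |A|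
    / 4 sample points guaranteed by \<open>S_large\<close>.\<close>
  define L where "L = {j \<in> C. real z \<le> real k * real (card (A j))}"
  define T where "T j = S \<inter> A j \<inter> R" for j
  define G where "G = {j \<in> L. p * real (card (A j)) / 8 \<le> real (card (T j))}"
  have finG: "finite L" "finite G" "finite C" "G \<subseteq> L" "L \<subseteq> C"
    using Cf by (auto simp: L_def G_def)
  have T_ne: "T j \<noteq> {}" if "j \<in> G" for j
  proof -
    have "real k * real (card (A j)) \<ge> 1" and "p * real (card (A j)) / 8 \<le> real (card (T j))"
      using that z by (auto simp: G_def L_def)
    then have "0 < real (card (A j))"
      by (cases "card (A j) = 0") auto
    then have "0 < p * real (card (A j)) / 8"
      using p by simp
    then have "0 < real (card (T j))"
      using \<open>p * real (card (A j)) / 8 \<le> real (card (T j))\<close> by linarith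
    then show ?thesis
      by (auto simp del: of_nat_0_less_iff)
  qed
  define U where "U = {x \<in> Q. g x \<in> G}"
  have UX: "U \<subseteq> X"
    using Q by (auto simp: U_def)

  \<comment> \<open>Each of the at most k clusters outside \<open>L\<close> has fewer than z / k
    points.\<close>
  have small: "(\<Sum>j\<in>C - L. real (card (A j))) \<le> real z"
  proof -
    have "(\<Sum>j\<in>C - L. real (card (A j))) \<le> (\<Sum>j\<in>C - L. real z / real k)"
      using dk by (intro sum_mono) (auto simp: L_def field_simps)
    also have "\<dots> \<le> (\<Sum>j\<in>C. real z / real k)"
      using Cf by (intro sum_mono2) auto
    also have "\<dots> = real z"
      using C dk by (simp add: centers_def)
    finally show ?thesis .
  qed
  \<comment> \<open>A cluster in \<open>L - G\<close> loses at least p |A| / 8 sample points to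
    discarding. At most 2.5 \<open>\<kappa>1\<close> p z are discarded in total, and 8 * 2.5 =
    20.\<close>
  have lost: "(\<Sum>j\<in>L - G. real (card (A j))) \<le> 20 * \<kappa>1 * real z"
  proof -
    have "real (card (A j)) \<le> 8 / p * real (card {x \<in> S - R. x \<in> Q \<and> g x = j})" if j: "j \<in> L - G" for j
    proof -
      have "p * real (card (A j)) / 4 \<le> real (card (S \<inter> A j))"
        using S_large[of j] j by (auto simp: L_def A_def)
      also have "card (S \<inter> A j) = card (T j) + card {x \<in> S - R. x \<in> Q \<and> g x = j}"
        using fin by (subst card_Un_disjoint[symmetric]) (auto simp: T_def A_def intro!: arg_cong[where f = card])
      finally have "p * real (card (A j)) / 8 \<le> real (card {x \<in> S - R. x \<in> Q \<and> g x = j})"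
        using j by (auto simp: G_def)
      then show ?thesis
        using p by (simp add: field_simps)
    qed
    then have "(\<Sum>j\<in>L - G. real (card (A j))) \<le> (\<Sum>j\<in>L - G. 8 / p * real (card {x \<in> (S - R) \<inter> Q. g x = j}))"
      by (intro sum_mono) (simp add: conj_assoc)
    also have "\<dots> = 8 / p * real (card {x \<in> (S - R) \<inter> Q. g x \<in> L - G})"
      using fin finG by (subst sum_card_fibres[symmetric]) (auto simp: sum_distrib_left)
    also have "\<dots> \<le> 8 / p * real (card (S - R))"
      using p fin by (intro mult_left_mono) (auto intro!: card_mono)
    also have "\<dots> \<le> 8 / p * (\<kappa>1 * z')"
      using p R by (intro mult_left_mono) auto
    also have "\<dots> = 20 * \<kappa>1 * real z"
      using p by (simp add: z'_def)
    finally show ?thesis .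
  qed
  \<comment> \<open>The reference outliers and the small clusters contribute z each, the lost
    clusters 20 \<open>\<kappa>1\<close> z.\<close>
  have card_XU: "real (card (X - U)) \<le> 22 * \<kappa>1 * real z"
  proof -
    have "card (X - U) \<le> card ((X - Q) \<union> {x \<in> Q. g x \<in> (C - L) \<union> (L - G)})"
      using X fin g(1) by (intro card_mono) (auto simp: U_def)
    also have "\<dots> \<le> card (X - Q) + card {x \<in> Q. g x \<in> (C - L) \<union> (L - G)}"
      by (rule card_Un_le)
    finally have "real (card (X - U)) \<le> real z + real (card {x \<in> Q. g x \<in> (C - L) \<union> (L - G)})"
      using Q(2) by linarith
    also have "real (card {x \<in> Q. g x \<in> (C - L) \<union> (L - G)}) = (\<Sum>j\<in>(C - L) \<union> (L - G). real (card (A j)))"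
      unfolding A_def using fin finG by (intro sum_card_fibres[symmetric]) auto
    also have "\<dots> = (\<Sum>j\<in>C - L. real (card (A j))) + (\<Sum>j\<in>L - G. real (card (A j)))"
      using finG by (intro sum.union_disjoint) auto
    also have "real z + \<dots> \<le> real z + (real z + 20 * \<kappa>1 * real z)"
      using small lost by simp
    also have "\<dots> \<le> 22 * \<kappa>1 * real z"
      using mult_right_mono[of 1 \<kappa>1 "real z"] \<kappa> by (simp add: algebra_simps)
    finally show ?thesis .
  qed

  have "cost d (mset_set X) (22 * \<kappa>1 * real z) D \<le> (\<Sum>x\<in>U. dsq d x D)"
    by (rule cost_set_le[OF Df X UX card_XU])
  also have "\<dots> = (\<Sum>j\<in>G. \<Sum>x\<in>A j. dsq d x D)"
    unfolding U_def A_def using fin finG by (intro sum_fibres[symmetric]) auto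
  also have "\<dots> \<le> (\<Sum>j\<in>G. 4 * (\<Sum>x\<in>A j. sqd d x j)
      + 8 / p * (4 * (\<Sum>s\<in>T j. sqd d s j) + 2 * (\<Sum>s\<in>T j. dsq d s D)))"
    using fin T_ne p by (intro sum_mono sum_dsq_le_by_sample Df) (auto simp: T_def G_def)
  also have "\<dots> = 4 * (\<Sum>j\<in>G. \<Sum>x\<in>A j. sqd d x j)
      + 8 / p * (4 * (\<Sum>j\<in>G. \<Sum>s\<in>T j. sqd d s j) + 2 * (\<Sum>j\<in>G. \<Sum>s\<in>T j. dsq d s D))"
    by (simp add: sum.distrib flip: sum_distrib_left sum_divide_distrib)
  \<comment> \<open>Sampled costs are of order p c and 8 / p scales them back: 4 c + 128 c + 64
    \<open>\<kappa>2\<close> c <= 196 \<open>\<kappa>2\<close> c. The final factor 2 comes from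
    \<open>opt\<close>.\<close>
  also have "\<dots> \<le> 4 * c + 8 / p * (4 * (4 * (p * c)) + 2 * (\<kappa>2 * (4 * (p * c))))"
  proof (intro add_mono mult_left_mono)
    have "(\<Sum>j\<in>G. \<Sum>x\<in>A j. sqd d x j) = (\<Sum>j\<in>G. \<Sum>x | x \<in> Q \<and> g x = j. sqd d x (g x))"
      by (intro sum.cong) (auto simp: A_def)
    also have "\<dots> = (\<Sum>x | x \<in> Q \<and> g x \<in> G. sqd d x (g x))"
      using fin finG by (intro sum_fibres)
    also have "\<dots> \<le> c"
      unfolding c_def using fin by (intro sum_mono2) auto
    finally show "(\<Sum>j\<in>G. \<Sum>x\<in>A j. sqd d x j) \<le> c" .
    have "(\<Sum>j\<in>G. \<Sum>s\<in>T j. sqd d s j) = (\<Sum>j\<in>G. \<Sum>x | x \<in> S \<inter> Q \<inter> R \<and> g x = j. sqd d x (g x))"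
      by (intro sum.cong) (auto simp: A_def T_def)
    also have "\<dots> = (\<Sum>x | x \<in> S \<inter> Q \<inter> R \<and> g x \<in> G. sqd d x (g x))"
      using fin finG by (intro sum_fibres) auto
    also have "\<dots> \<le> (\<Sum>x\<in>S \<inter> Q. sqd d x (g x))"
      using fin by (intro sum_mono2) auto
    finally show "(\<Sum>j\<in>G. \<Sum>s\<in>T j. sqd d s j) \<le> 4 * (p * c)"
      using S_cost by (simp add: c_def)
    have "(\<Sum>j\<in>G. \<Sum>s\<in>T j. dsq d s D) = (\<Sum>j\<in>G. \<Sum>x | x \<in> S \<inter> Q \<inter> R \<and> g x = j. dsq d x D)"
      by (intro sum.cong) (auto simp: A_def T_def)
    also have "\<dots> = (\<Sum>x | x \<in> S \<inter> Q \<inter> R \<and> g x \<in> G. dsq d x D)"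
      using fin finG by (intro sum_fibres) auto
    also have "\<dots> \<le> (\<Sum>x\<in>R. dsq d x D)"
      using finR by (intro sum_mono2) auto
    finally show "(\<Sum>j\<in>G. \<Sum>s\<in>T j. dsq d s D) \<le> \<kappa>2 * (4 * (p * c))"
      using le' R(3) by simp
  qed (use p in auto)
  also have "\<dots> = 132 * c + 64 * (\<kappa>2 * c)"
    using p by (simp add: field_simps)
  also have "\<dots> \<le> 196 * \<kappa>2 * c"
    using mult_right_mono[of 1 \<kappa>2 c] \<kappa> c by simp
  also have "\<dots> \<le> 196 * \<kappa>2 * (2 * Opt d (mset_set X) k z)"
    using opt \<kappa> by (intro mult_left_mono) (auto simp: c_def)
  finally show "cost d (mset_set X) (22 * \<kappa>1 * real z) D \<le> 392 * \<kappa>2 * Opt d (mset_set X) k (real z)"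
    by simp
qed

section \<open>Deviation bounds for the random subsample\<close>

lemma set_pmf_subsample: "set_pmf (subsample X p) \<subseteq> Pow X"
  by (auto simp: subsample_def)

lemma integrable_subsample:
  fixes f :: "point set \<Rightarrow> real"
  assumes "finite X"
  shows "integrable (measure_pmf (subsample X p)) f"
  using finite_subset[OF set_pmf_subsample] assms by (intro integrable_measure_pmf_finite) auto

lemma prob_mem_subsample:
  assumes "finite X" "x \<in> X" "0 \<le> p" "p \<le> 1"
  shows "measure_pmf.prob (subsample X p) {S. x \<in> S} = p"
proof -
  have "measure_pmf.prob (subsample X p) {S. x \<in> S}
      = measure_pmf.prob (map_pmf (\<lambda>b. b x) (Pi_pmf X False (\<lambda>_. bernoulli_pmf p))) {True}"
    using assms(2) by (simp add: subsample_def vimage_def)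
  also have "\<dots> = p"
    using assms by (simp add: Pi_pmf_component measure_pmf_single)
  finally show ?thesis .
qed

lemma expectation_subsample_sum:
  fixes h :: "point \<Rightarrow> real"
  assumes "finite X" "A \<subseteq> X" "0 \<le> p" "p \<le> 1"
  shows "measure_pmf.expectation (subsample X p) (\<lambda>S. \<Sum>x\<in>S \<inter> A. h x) = p * (\<Sum>x\<in>A. h x)"
proof -
  have "finite A"
    using assms finite_subset by auto
  have "measure_pmf.expectation (subsample X p) (\<lambda>S. \<Sum>x\<in>S \<inter> A. h x)
     = measure_pmf.expectation (subsample X p) (\<lambda>S. \<Sum>x\<in>A. h x * indicator {S. x \<in> S} S)"
    using \<open>finite A\<close>
    by (intro Bochner_Integration.integral_cong refl sum.mono_neutral_cong_left) (auto simp: indicator_def)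
  also have "\<dots> = (\<Sum>x\<in>A. measure_pmf.expectation (subsample X p) (\<lambda>S. h x * indicator {S. x \<in> S} S))"
    using assms by (intro Bochner_Integration.integral_sum integrable_subsample)
  also have "\<dots> = (\<Sum>x\<in>A. h x * p)"
    using assms by (intro sum.cong) (auto simp: prob_mem_subsample)
  finally show ?thesis
    by (simp add: sum_distrib_left mult.commute)
qed

text \<open>Markov's inequality. With mean 0 the sum vanishes almost surely, and the strict
  comparison makes the bound hold then too.\<close>

lemma prob_subsample_sum_gt:
  fixes h :: "point \<Rightarrow> real"
  assumes "finite X" "A \<subseteq> X" "0 \<le> p" "p \<le> 1" "\<And>x. 0 \<le> h x" "0 < a"
  shows "measure_pmf.prob (subsample X p) {S. a * (p * (\<Sum>x\<in>A. h x)) < (\<Sum>x\<in>S \<inter> A. h x)} \<le> 1 / a"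
proof -
  define \<mu> where "\<mu> = p * (\<Sum>x\<in>A. h x)"
  define f where "f S = (\<Sum>x\<in>S \<inter> A. h x)" for S
  let ?M = "subsample X p"
  have \<mu>: "0 \<le> \<mu>" and f: "0 \<le> f S" for S
    using assms by (simp_all add: \<mu>_def f_def sum_nonneg)
  have E: "measure_pmf.expectation ?M f = \<mu>"
    unfolding f_def \<mu>_def using assms by (intro expectation_subsample_sum)
  have int: "integrable (measure_pmf ?M) f"
    by (rule integrable_subsample[OF assms(1)])
  show ?thesis
  proof (cases "\<mu> = 0")
    case True
    then have "AE S in ?M. f S = 0"
      using E integral_nonneg_eq_0_iff_AE[OF int] f by simp
    then have "measure_pmf.prob ?M {S. 0 < f S} = 0"
      by (subst measure_pmf.prob_eq_0) (auto elim: eventually_mono)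
    then show ?thesis
      unfolding \<mu>_def[symmetric] f_def[symmetric] using True assms(6) by simp
  next
    case False
    then have pos: "0 < a * \<mu>"
      using \<mu> assms by simp
    have "measure_pmf.prob ?M {S. a * \<mu> < f S} \<le> measure_pmf.prob ?M {S. a * \<mu> \<le> f S}"
      by (intro measure_pmf.finite_measure_mono) auto
    also have "\<dots> \<le> \<mu> / (a * \<mu>)"
      using integral_Markov_inequality_measure[OF int, of "{}" "a * \<mu>"] pos f E by simp
    also have "\<dots> = 1 / a"
      using False by simp
    finally show ?thesis
      by (simp add: \<mu>_def f_def)
  qed
qed

text \<open>An exponential moment with base 1/2: by independence its expectation is (1 - p/2)^|A| <=
  exp(- p |A| / 2), while on the event it is at least exp(- p |A| / 4).\<close>

lemma prob_subsample_card_lt: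
  assumes "finite X" "A \<subseteq> X" "0 \<le> p" "p \<le> 1"
  shows "measure_pmf.prob (subsample X p) {S. real (card (S \<inter> A)) < p * real (card A) / 4}
    \<le> exp (- (p * real (card A) / 4))"
proof -
  let ?M = "subsample X p"
  define a where "a = p * real (card A)"
  define f :: "point set \<Rightarrow> real" where "f S = (1 / 2) ^ card (S \<inter> A)" for S
  have f_nonneg: "0 \<le> f S" for S
    by (simp add: f_def)
  have "measure_pmf.expectation ?M f
      = measure_pmf.expectation (Pi_pmf X False (\<lambda>_. bernoulli_pmf p))
          (\<lambda>b. \<Prod>x\<in>X. (if x \<in> A \<and> b x then 1 / 2 else 1))"
  proof -
    have "f {x \<in> X. b x} = (\<Prod>x\<in>X. (if x \<in> A \<and> b x then 1 / 2 else 1))" for b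
    proof -
      have "{x \<in> X. b x} \<inter> A = {x \<in> X. x \<in> A \<and> b x}"
        by auto
      then show ?thesis
        using assms(1) by (simp add: f_def prod.If_cases Int_def)
    qed
    then show ?thesis
      by (simp add: subsample_def)
  qed
  also have "\<dots> = (\<Prod>x\<in>X. measure_pmf.expectation (bernoulli_pmf p) (\<lambda>v. if x \<in> A \<and> v then 1 / 2 else 1))"
    using assms(1) by (intro expectation_prod_Pi_pmf[where f = "\<lambda>x v. if x \<in> A \<and> v then 1 / 2 else 1"]
        integrable_measure_pmf_finite) auto
  also have "\<dots> = (\<Prod>x\<in>X. if x \<in> A then 1 - p / 2 else 1)"
    using assms by (intro prod.cong) (auto simp: algebra_simps)
  also have "\<dots> = (1 - p / 2) ^ card A"
    using assms by (simp add: prod.If_cases Int_absorb1 Int_def[symmetric])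
  also have "\<dots> \<le> exp (- (p / 2)) ^ card A"
    using assms exp_ge_add_one_self[of "- (p / 2)"] by (intro power_mono) auto
  also have "\<dots> = exp (- (a / 2))"
    by (simp add: a_def algebra_simps flip: exp_of_nat_mult)
  finally have E: "measure_pmf.expectation ?M f \<le> exp (- (a / 2))" .
  have "measure_pmf.prob ?M {S. real (card (S \<inter> A)) < a / 4} \<le> measure_pmf.prob ?M {S. exp (- (a / 4)) \<le> f S}"
  proof (intro measure_pmf.finite_measure_mono subsetI, clarify)
    fix S assume S: "real (card (S \<inter> A)) < a / 4"
    \<comment> \<open>This exchanges the base 1/2 of the moment for exp(-1).\<close>
    have "exp (-1) \<le> (1 / 2 :: real)"
      using exp_ge_add_one_self[of 1] by (simp add: exp_minus field_simps)
    have "exp (- (a / 4)) \<le> exp (- real (card (S \<inter> A)))"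
      using S by simp
    also have "\<dots> = exp (-1) ^ card (S \<inter> A)"
      by (simp flip: exp_of_nat_mult)
    also have "\<dots> \<le> f S"
      unfolding f_def using \<open>exp (-1) \<le> 1 / 2\<close> by (intro power_mono) auto
    finally show "exp (- (a / 4)) \<le> f S" .
  qed simp
  also have "\<dots> \<le> measure_pmf.expectation ?M f / exp (- (a / 4))"
    using integral_Markov_inequality_measure[OF integrable_subsample[OF assms(1)], of "{}" p f "exp (- (a / 4))"] f_nonneg
    by simp
  also have "\<dots> \<le> exp (- (a / 2)) / exp (- (a / 4))"
    by (intro divide_right_mono E) auto
  also have "\<dots> = exp (- (a / 4))"
    by (simp flip: exp_diff)
  finally show ?thesis
    by (simp add: a_def)
qed

section \<open>Bounds on the sampling probability\<close>

lemma sample_prob_bounds: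
  assumes "1 \<le> k" "1 \<le> z"
  shows "0 < sample_prob n k z" "36 * real k * ln (2 * real k ^ 3) \<le> sample_prob n k z * real z"
proof -
  have "36 * real k / real z * ln (2 * real k ^ 3) \<le> sample_prob n k z"
    by (simp add: sample_prob_def)
  moreover have "1 < 2 * real k ^ 3"
    using assms one_le_power[of "real k" 3] by linarith
  then have "0 < 36 * real k / real z * ln (2 * real k ^ 3)"
    using assms by simp
  ultimately show "0 < sample_prob n k z"
    by linarith
  show "36 * real k * ln (2 * real k ^ 3) \<le> sample_prob n k z * real z"
    using \<open>36 * real k / real z * ln (2 * real k ^ 3) \<le> sample_prob n k z\<close> assms
    by (simp add: field_simps)
qed

text \<open>For k < n and n >= 2 the arguments of the logarithms are at most n^5 and n^4, using 4 <=
  n^2 and 2 <= n; then 180 = 36 * 5.\<close>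

lemma sample_prob_le:
  assumes "1 \<le> k" "1 \<le> z" "k < n"
  shows "sample_prob n k z * real z \<le> 180 * (real k * ln (real n))"
proof -
  have n: "2 \<le> real n" "1 \<le> real k" "real k \<le> real n" "1 \<le> real z"
    using assms by linarith+
  then have ln0: "0 \<le> ln (real n)"
    by simp
  have "4 * real n * (real k)\<^sup>2 / real z \<le> 4 * real n * (real k)\<^sup>2 / 1"
    using n by (intro divide_left_mono) auto
  also have "\<dots> \<le> (real n)\<^sup>2 * real n * (real n)\<^sup>2"
    unfolding div_by_1 using n power_mono[of 2 "real n" 2] by (intro mult_mono power_mono) auto
  also have "\<dots> = real n ^ 5"
    by (simp add: power_numeral_reduce)
  finally have "ln (4 * real n * (real k)\<^sup>2 / real z) \<le> ln (real n ^ 5)"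
    using n by (subst ln_le_cancel_iff) auto
  also have "\<dots> = 5 * ln (real n)"
    using n by (simp add: ln_realpow)
  also have "\<dots> \<le> 5 * (real k * ln (real n))"
    using n ln0 mult_right_mono[of 1 "real k" "ln (real n)"] by simp
  finally have 1: "36 * ln (4 * real n * (real k)\<^sup>2 / real z) \<le> 180 * (real k * ln (real n))"
    by simp
  have "2 * real k ^ 3 \<le> real n * real n ^ 3"
    using n by (auto intro!: mult_mono power_mono)
  also have "\<dots> = real n ^ 4"
    by (simp add: power_numeral_reduce)
  finally have "ln (2 * real k ^ 3) \<le> ln (real n ^ 4)"
    using n by (subst ln_le_cancel_iff) auto
  also have "\<dots> = 4 * ln (real n)"
    using n by (simp add: ln_realpow)
  finally have "36 * real k * ln (2 * real k ^ 3) \<le> 36 * real k * (4 * ln (real n))"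
    by (intro mult_left_mono) auto
  also have "\<dots> \<le> 180 * (real k * ln (real n))"
    using ln0 by (simp add: mult_right_mono)
  finally have 2: "36 * real k * ln (2 * real k ^ 3) \<le> 180 * (real k * ln (real n))" .
  have "sample_prob n k z * real z =
      max (36 * ln (4 * real n * (real k)\<^sup>2 / real z)) (36 * real k * ln (2 * real k ^ 3))"
    using n by (simp add: sample_prob_def max_mult_distrib_right)
  with 1 2 show ?thesis
    by simp
qed

text \<open>A union bound over three failures: too many outliers (2/5), too much cost (1/4), some
  large cluster underrepresented (1/8). They add up to 31/40.\<close>

lemma prob_subsample_coreset:
  fixes k z :: nat
  assumes dk: "1 \<le> d" "1 \<le> k" and X: "finite X" "X \<subseteq> topspace (Euclidean_space d)" and z: "1 \<le> z"
    and p: "0 < p" "p \<le> 1" and pz: "36 * real k * ln (2 * real k ^ 3) \<le> p * real z"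
  shows "9 / 40 \<le> measure_pmf.prob (subsample X p)
    {S. S \<subseteq> X \<and> is_coreset d k 22 392 (mset_set S) (2.5 * p * real z) (mset_set X) (real z)}"
proof -
  obtain C Q g where C: "C \<in> centers d k" and Q: "Q \<subseteq> X" "real (card (X - Q)) \<le> real z"
    and g: "\<And>x. g x \<in> C" "\<And>x. dsq d x C = sqd d x (g x)"
      "(\<Sum>x\<in>Q. sqd d x (g x)) \<le> 2 * Opt d (mset_set X) k z"
    using optimal_clustering[OF dk X, of "real z"] by auto
  note Cf = centersD[OF C dk(2)]
  define A where "A j = {x \<in> Q. g x = j}" for j
  define L where "L = {j \<in> C. real z \<le> real k * real (card (A j))}"
  let ?M = "subsample X p"
  define E1 where "E1 = {S :: point set. 2.5 * p * real z < real (card (S \<inter> (X - Q)))}"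
  define E2 where "E2 = {S. 4 * (p * (\<Sum>x\<in>Q. sqd d x (g x))) < (\<Sum>x\<in>S \<inter> Q. sqd d x (g x))}"
  define E3 where "E3 j = {S. real (card (S \<inter> A j)) < p * real (card (A j)) / 4}" for j
  have "measure_pmf.prob ?M E1
      \<le> measure_pmf.prob ?M {S. 2.5 * (p * (\<Sum>x\<in>X - Q. 1)) < (\<Sum>x\<in>S \<inter> (X - Q). 1)}"
  proof (intro measure_pmf.finite_measure_mono)
    have "2.5 * (p * real (card (X - Q))) \<le> 2.5 * p * real z"
      using Q p by simp
    then show "E1 \<subseteq> {S. 2.5 * (p * (\<Sum>x\<in>X - Q. 1)) < (\<Sum>x\<in>S \<inter> (X - Q). 1)}"
      by (auto simp: E1_def)
  qed simp
  also have "\<dots> \<le> 1 / 2.5"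
    using X p by (intro prob_subsample_sum_gt) auto
  finally have E1: "measure_pmf.prob ?M E1 \<le> 2 / 5"
    by simp
  have E2: "measure_pmf.prob ?M E2 \<le> 1 / 4"
    unfolding E2_def using X p Q by (intro prob_subsample_sum_gt) auto
  have k3: "1 \<le> real k ^ 3" "real k \<le> real k ^ 3"
    using dk power_increasing[of 1 3 "real k"] by auto
  define l where "l = ln (2 * real k ^ 3)"
  have l: "0 \<le> l"
    using k3 by (simp add: l_def)
  have E3: "measure_pmf.prob ?M (E3 j) \<le> 1 / (8 * real k)" if j: "j \<in> L" for j
  proof -
    have "measure_pmf.prob ?M (E3 j) \<le> exp (- (p * real (card (A j)) / 4))"
      unfolding E3_def using X p Q by (intro prob_subsample_card_lt) (auto simp: A_def)
    \<comment> \<open>A cluster in \<open>L\<close> has k |A| >= z, so p |A| >= 36 l. Already exp(-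
      3 l) = 1 / (8 k^9) suffices to sum over k clusters.\<close>
    also have "\<dots> \<le> exp (- (3 * l))"
    proof -
      have "real k * (36 * l) \<le> p * real z"
        using pz by (simp add: l_def)
      also have "\<dots> \<le> p * (real k * real (card (A j)))"
        using j p by (intro mult_left_mono) (auto simp: L_def)
      also have "\<dots> = real k * (p * real (card (A j)))"
        by simp
      finally have "36 * l \<le> p * real (card (A j))"
        using dk by (simp add: mult_le_cancel_left)
      then show ?thesis
        using l by simp
    qed
    also have "\<dots> = 1 / exp l ^ 3"
      by (simp add: exp_minus field_simps flip: exp_of_nat_mult)
    also have "exp l = 2 * real k ^ 3"
      using dk by (simp add: l_def)
    also have "1 / (2 * real k ^ 3) ^ 3 \<le> 1 / (8 * real k)"
    proof -
      have "real k \<le> (real k ^ 3) ^ 3"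
        using k3 self_le_power[of "real k ^ 3" 3] by linarith
      then show ?thesis
        using dk by (intro divide_left_mono) (auto simp: power_mult_distrib)
    qed
    finally show ?thesis .
  qed
  have fL: "finite L"
    using Cf by (simp add: L_def)
  have "measure_pmf.prob ?M (\<Union>j\<in>L. E3 j) \<le> (\<Sum>j\<in>L. measure_pmf.prob ?M (E3 j))"
    using fL by (intro measure_pmf.finite_measure_subadditive_finite) auto
  also have "\<dots> \<le> (\<Sum>j\<in>L. 1 / (8 * real k))"
    by (intro sum_mono E3)
  also have "\<dots> \<le> (\<Sum>j\<in>C. 1 / (8 * real k))"
    using Cf by (intro sum_mono2) (auto simp: L_def)
  also have "\<dots> = 1 / 8"
    using C dk by (simp add: centers_def)
  finally have E3': "measure_pmf.prob ?M (\<Union>j\<in>L. E3 j) \<le> 1 / 8" .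
  define F where "F = E1 \<union> (E2 \<union> (\<Union>j\<in>L. E3 j))"
  have "measure_pmf.prob ?M F \<le> measure_pmf.prob ?M E1 + (measure_pmf.prob ?M E2 + measure_pmf.prob ?M (\<Union>j\<in>L. E3 j))"
    unfolding F_def by (intro order_trans[OF measure_Un_le] add_left_mono) auto
  then have "measure_pmf.prob ?M F \<le> 31 / 40"
    using E1 E2 E3' by linarith
  then have "9 / 40 \<le> measure_pmf.prob ?M (- F)"
    using measure_pmf.prob_compl[of F ?M] by (simp add: Compl_eq_Diff_UNIV)
  also have "\<dots> \<le> measure_pmf.prob ?M
    {S. S \<subseteq> X \<and> is_coreset d k 22 392 (mset_set S) (2.5 * p * real z) (mset_set X) (real z)}"
  proof (rule measure_pmf.finite_measure_mono_AE)
    have "is_coreset d k 22 392 (mset_set S) (2.5 * p * real z) (mset_set X) (real z)"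
      if S: "S \<subseteq> X" "S \<notin> F" for S
    proof (rule is_coreset_subsample[OF dk X(1) z p(1) C Q(1) _ g S(1)])
      show "card (X - Q) \<le> z"
        using Q by simp
      show "real (card (S \<inter> (X - Q))) \<le> 2.5 * p * real z"
        "(\<Sum>x\<in>S \<inter> Q. sqd d x (g x)) \<le> 4 * (p * (\<Sum>x\<in>Q. sqd d x (g x)))"
        using S(2) by (auto simp: F_def E1_def E2_def)
      show "p * real (card {x \<in> Q. g x = j}) / 4 \<le> real (card (S \<inter> {x \<in> Q. g x = j}))"
        if "j \<in> C" "real z \<le> real k * real (card {x \<in> Q. g x = j})" for j
        using S(2) that by (auto simp: F_def E3_def L_def A_def not_less)
    qed
    then show "AE S in ?M. S \<in> - F \<longrightarrow> S \<in> {S. S \<subseteq> X \<and>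
        is_coreset d k 22 392 (mset_set S) (2.5 * p * real z) (mset_set X) (real z)}"
      using set_pmf_subsample[of X p] by (auto simp: AE_measure_pmf_iff)
  qed simp
  finally show ?thesis .
qed

section \<open>Output size and the combination of both stages\<close>

lemma set_pmf_kmeanspp:
  assumes "finite P" "P \<subseteq> topspace (Euclidean_space d)" "(Y, w) \<in> set_pmf (kmeanspp d \<tau> P m)"
  shows "card Y \<le> m" "card Y \<le> card P"
proof -
  obtain ys where ys: "ys \<in> set_pmf (d2_sample d P m)" "Y = set ys"
    using assms(3) by (auto simp: kmeanspp_def)
  note * = set_pmf_d2_sample[OF assms(1,2) ys(1)]
  show "card Y \<le> m"
    using * card_length[of ys] ys(2) by simp
  show "card Y \<le> card P"
    using * ys(2) assms(1) by (simp add: card_mono)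
qed

lemma finite_set_pmf_kmeanspp:
  "\<lbrakk>finite P; P \<subseteq> topspace (Euclidean_space d)\<rbrakk> \<Longrightarrow> finite (set_pmf (kmeanspp d \<tau> P m))"
  by (simp add: kmeanspp_def finite_set_pmf_d2_sample)

text \<open>The first stage succeeds with probability at least \<open>a\<close>, and given this the
  second with probability at least \<open>b\<close>.\<close>

lemma prob_bind_pmf_ge:
  assumes "finite (set_pmf M)" "\<And>x. x \<in> set_pmf M \<Longrightarrow> finite (set_pmf (f x))" "0 \<le> b"
    and G: "a \<le> measure_pmf.prob M G" "\<And>x. x \<in> set_pmf M \<Longrightarrow> x \<in> G \<Longrightarrow> b \<le> measure_pmf.prob (f x) E"
  shows "a * b \<le> measure_pmf.prob (bind_pmf M f) E"
proof -
  have "a * b \<le> measure_pmf.prob M G * b"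
    using assms by (intro mult_right_mono)
  also have "\<dots> = measure_pmf.expectation M (\<lambda>x. indicator G x * b)"
    by simp
  also have "\<dots> = (\<Sum>x\<in>set_pmf M. pmf M x *\<^sub>R (indicator G x * b))"
    using assms(1) by (intro integral_measure_pmf) auto
  also have "\<dots> \<le> (\<Sum>x\<in>set_pmf M. pmf M x *\<^sub>R measure_pmf.expectation (f x) (indicator E))"
    using G(2) by (intro sum_mono scaleR_left_mono) (auto simp: indicator_def)
  also have "\<dots> = measure_pmf.expectation (bind_pmf M f) (indicator E)"
    using assms by (intro pmf_expectation_bind[symmetric]) auto
  finally show ?thesis
    by simp
qed

text \<open>The bound holds for every outcome. If n <= k, the output is part of \<open>X\<close>.
  Otherwise the number of draws is bounded via p z = O(k ln n), with z < p z when p > 1; n >= 2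
  makes ln n at least 1/2, which absorbs terms of order k.\<close>

lemma set_pmf_sample_coreset:
  assumes X: "finite X" "X \<subseteq> topspace (Euclidean_space d)" and n: "2 \<le> card X"
    and kz: "1 \<le> k" "1 \<le> z" and Yw: "(Y, w) \<in> set_pmf (sample_coreset d \<tau> X k z)"
  shows "real (card Y) \<le> 15000 * real k * ln (real (card X))"
proof -
  define n where "n = card X"
  define p where "p = sample_prob n k z"
  define m where "m = (if p > 1 then 32 * (k + z) else nat \<lceil>32 * (real k + 2.5 * p * real z)\<rceil>)"
  have "\<exists>P\<subseteq>X. (Y, w) \<in> set_pmf (kmeanspp d \<tau> P m)"
    using Yw set_pmf_subsample[of X p]
    by (auto simp: sample_coreset_def Let_def m_def p_def n_def split: if_splits)
  then obtain P where P: "P \<subseteq> X" "(Y, w) \<in> set_pmf (kmeanspp d \<tau> P m)"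
    by blast
  then have "finite P" "P \<subseteq> topspace (Euclidean_space d)"
    using X finite_subset by blast+
  note card_Y = set_pmf_kmeanspp[OF this P(2)]
  have "1 / 2 \<le> ln (2::real)"
    using ln2_ge_two_thirds by simp
  also have "\<dots> \<le> ln (real n)"
    using n by (simp add: n_def)
  finally have ln: "1 / 2 \<le> ln (real n)" .
  have kln: "real k \<le> 2 * (real k * ln (real n))"
    using mult_left_mono[OF ln, of "real k"] by simp
  have p: "0 < p"
    unfolding p_def by (rule sample_prob_bounds[OF kz])
  show ?thesis
  proof (cases "n \<le> k")
    case True
    have "card Y \<le> k"
      using card_Y(2) P(1) X(1) True card_mono[of X P] by (simp add: n_def)
    then show ?thesis
      using kln by (simp add: n_def)
  next
    case False
    then have pz: "p * real z \<le> 180 * (real k * ln (real n))"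
      unfolding p_def using kz by (intro sample_prob_le) auto
    have "real m \<le> 15000 * (real k * ln (real n))"
    proof (cases "p > 1")
      case True
      then have "real z \<le> p * real z"
        using mult_right_mono[of 1 p "real z"] by simp
      then show ?thesis
        using True pz kln by (simp add: m_def)
    next
      case False
      have "0 \<le> 32 * (real k + 2.5 * p * real z)"
        using p by simp
      then have "real m \<le> 32 * (real k + 2.5 * p * real z) + 1"
        using False unfolding m_def by (simp only: if_False) linarith
      \<comment> \<open>The three terms contribute 64, 80 * 180 = 14400 and, for the rounding, 2
        multiples of k ln n.\<close>
      then have "real m \<le> 32 * real k + 80 * (p * real z) + 1"
        by simp
      moreover have "1 \<le> real k"
        using kz by simp
      ultimately show ?thesis
        using pz kln by linarith
    qed
    then show ?thesis
      using card_Y(1) by (simp add: n_def)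
  qed
qed

lemma expectation_sample_coreset_card:
  assumes "finite X" "X \<subseteq> topspace (Euclidean_space d)" "2 \<le> card X" "1 \<le> k" "1 \<le> z"
  shows "measure_pmf.expectation (sample_coreset d \<tau> X k z) (\<lambda>(Y, w). real (card Y))
    \<le> 15000 * real k * ln (real (card X))"
proof (rule measure_pmf.integral_le_const)
  let ?M = "measure_pmf (sample_coreset d \<tau> X k z)" and ?B = "15000 * real k * ln (real (card X))"
  show AE: "AE Yw in ?M. (case Yw of (Y, w) \<Rightarrow> real (card Y)) \<le> ?B"
    using set_pmf_sample_coreset[OF assms] by (auto simp: AE_measure_pmf_iff)
  show "integrable ?M (\<lambda>(Y, w). real (card Y))"
    by (rule measure_pmf.integrable_const_bound[where B = ?B]) (use AE in \<open>auto simp: case_prod_beta\<close>)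
qed

text \<open>For p > 1 the sampling stage alone suffices. Otherwise the two coreset properties
  compose, and the success probability is 9/40 * 15/31 > 1/10.\<close>

lemma prob_sample_coreset:
  fixes k z :: nat
  assumes dk: "1 \<le> d" "1 \<le> k" and X: "finite X" "X \<subseteq> topspace (Euclidean_space d)" and z: "1 \<le> z"
    and \<tau>: "closest_rule d \<tau>" and p: "p = sample_prob (card X) k z"
  shows "1 / 10 \<le> measure_pmf.prob (sample_coreset d \<tau> X k z)
    {(Y, w). is_coreset d k 22 (4856 * 392) (weighted_mset Y w)
      (if p > 1 then real z else 2.5 * p * real z) (mset_set X) (real z)}"
proof (cases "p > 1")
  case True
  have "15 / 31 \<le> measure_pmf.prob (kmeanspp d \<tau> X (32 * (k + z)))
    {(Y, w). is_coreset d k 1 4856 (weighted_mset Y w) (real z) (mset_set X) (real z)}"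
    by (rule kmeanspp_coreset[OF dk X _ _ \<tau>]) auto
  also have "\<dots> \<le> measure_pmf.prob (kmeanspp d \<tau> X (32 * (k + z)))
    {(Y, w). is_coreset d k 22 (4856 * 392) (weighted_mset Y w) (real z) (mset_set X) (real z)}"
    by (rule measure_pmf.finite_measure_mono) (auto intro: is_coreset_mono[OF _ _ _ dk])
  finally show ?thesis
    using True by (simp add: sample_coreset_def p)
next
  case False
  define m where "m = nat \<lceil>32 * (real k + 2.5 * p * real z)\<rceil>"
  note p_bounds = sample_prob_bounds[OF dk(2) z, of "card X", folded p]
  have pz: "0 \<le> 2.5 * p * real z"
    using p_bounds by simp
  have sub: "S \<subseteq> X" "finite S" "S \<subseteq> topspace (Euclidean_space d)" if "S \<in> set_pmf (subsample X p)" for S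
    using that set_pmf_subsample[of X p] X finite_subset by blast+
  have m: "32 * (k + nat \<lfloor>2.5 * p * real z\<rfloor>) \<le> m"
  proof -
    have "real (nat \<lfloor>2.5 * p * real z\<rfloor>) \<le> 2.5 * p * real z"
      using pz by linarith
    then have "real (32 * (k + nat \<lfloor>2.5 * p * real z\<rfloor>)) \<le> 32 * (real k + 2.5 * p * real z)"
      by simp
    also have "\<dots> \<le> real m"
      unfolding m_def by linarith
    finally show ?thesis
      by simp
  qed
  have "9 / 40 * (15 / 31) \<le> measure_pmf.prob (bind_pmf (subsample X p) (\<lambda>S. kmeanspp d \<tau> S m))
    {(Y, w). is_coreset d k 22 (4856 * 392) (weighted_mset Y w) (2.5 * p * real z) (mset_set X) (real z)}"
  proof (rule prob_bind_pmf_ge)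
    show "9 / 40 \<le> measure_pmf.prob (subsample X p)
      {S. S \<subseteq> X \<and> is_coreset d k 22 392 (mset_set S) (2.5 * p * real z) (mset_set X) (real z)}"
      using False p_bounds by (intro prob_subsample_coreset dk X z) auto
    show "finite (set_pmf (subsample X p))"
      using finite_subset[OF set_pmf_subsample] X by auto
    show "finite (set_pmf (kmeanspp d \<tau> S m))" if "S \<in> set_pmf (subsample X p)" for S
      using finite_set_pmf_kmeanspp[OF sub(2,3)[OF that]] .
    fix S assume S: "S \<in> set_pmf (subsample X p)"
      "S \<in> {S. S \<subseteq> X \<and> is_coreset d k 22 392 (mset_set S) (2.5 * p * real z) (mset_set X) (real z)}"
    have "15 / 31 \<le> measure_pmf.prob (kmeanspp d \<tau> S m)
      {(Y, w). is_coreset d k 1 4856 (weighted_mset Y w) (2.5 * p * real z) (mset_set S) (2.5 * p * real z)}"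
      by (rule kmeanspp_coreset[OF dk sub(2,3)[OF S(1)] pz m \<tau>])
    also have "\<dots> \<le> measure_pmf.prob (kmeanspp d \<tau> S m)
      {(Y, w). is_coreset d k 22 (4856 * 392) (weighted_mset Y w) (2.5 * p * real z) (mset_set X) (real z)}"
      using S(2) is_coreset_trans[of d k 1 4856 _ "2.5 * p * real z" "mset_set S" 22 392 "mset_set X" "real z"]
      by (intro measure_pmf.finite_measure_mono) auto
    finally show "15 / 31 \<le> measure_pmf.prob (kmeanspp d \<tau> S m)
      {(Y, w). is_coreset d k 22 (4856 * 392) (weighted_mset Y w) (2.5 * p * real z) (mset_set X) (real z)}" .
  qed auto
  moreover have "sample_coreset d \<tau> X k z = bind_pmf (subsample X p) (\<lambda>S. kmeanspp d \<tau> S m)"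
    using False by (simp add: sample_coreset_def p m_def Let_def)
  ultimately show ?thesis
    using False by simp
qed

text \<open>The constants precede all other quantifiers, so they depend neither on the dimension nor
  on the tie-breaking rule. The size bound asks for n >= 2, as ln 1 = 0 while a single point can
  yield a non-empty output.\<close>

theorem theorem4:
  "\<exists>\<alpha> \<beta> c K :: real. \<alpha> > 0 \<and> \<beta> > 0 \<and> c > 0 \<and> K > 0 \<and>
     (\<forall>(d::nat) (X::point set) (k::nat) (z::nat) \<tau>.
        d \<ge> 1 \<and> X \<subseteq> topspace (Euclidean_space d) \<and> finite X \<and> X \<noteq> {} \<and>
        k \<ge> 1 \<and> z \<ge> 1 \<and> closest_rule d \<tau> \<longrightarrow>
        (let n = card X;
             p = sample_prob n k z;
             z' = (if p > 1 then real z else 2.5 * p * real z);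
             A = sample_coreset d \<tau> X k z
         in measure_pmf.prob A
              {(Y, w). is_coreset d k \<alpha> \<beta> (weighted_mset Y w) z' (mset_set X) (real z)} \<ge> c \<and>
            (n \<ge> 2 \<longrightarrow>
              measure_pmf.expectation A (\<lambda>(Y, w). real (card Y)) \<le> K * real k * ln (real n))))"
proof (rule exI[of _ 22], rule exI[of _ "4856 * 392"], rule exI[of _ "1 / 10"], rule exI[of _ 15000],
    intro conjI allI impI)
  fix d k z :: nat and X :: "point set" and \<tau>
  assume *: "d \<ge> 1 \<and> X \<subseteq> topspace (Euclidean_space d) \<and> finite X \<and> X \<noteq> {} \<and>
        k \<ge> 1 \<and> z \<ge> 1 \<and> closest_rule d \<tau>"
  show "let n = card X;
             p = sample_prob n k z;
             z' = (if p > 1 then real z else 2.5 * p * real z);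
             A = sample_coreset d \<tau> X k z
         in measure_pmf.prob A
              {(Y, w). is_coreset d k 22 (4856 * 392) (weighted_mset Y w) z' (mset_set X) (real z)} \<ge> 1 / 10 \<and>
            (n \<ge> 2 \<longrightarrow>
              measure_pmf.expectation A (\<lambda>(Y, w). real (card Y)) \<le> 15000 * real k * ln (real n))"
    unfolding Let_def using * by (intro conjI impI prob_sample_coreset expectation_sample_coreset_card) auto
qed simp_all

end
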